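(* Let $\mathcal{E}_{\rm EVEN}=\mathcal{E}\cap K_{(2,2)}$ be the even part of the planar $3$-colorable subgroup $\mathcal{E}$ of Thompson's group $F$. Let $\alpha:F\to K_{(2,1)}$ and $\theta:F\to K_{(2,2)}$ be the isomorphisms determined by $$\alpha(x_0)=x_0x_1x_0^{-3},\quad \alpha(x_1)=x_0x_1^2x_0^{-3},\qquad \theta(x_0)=x_0x_1x_0^{-3}x_1^{-1},\quad \theta(x_1)=x_0x_1^2x_0^{-3}.$$ Then the quasi-regular representations of $F$ associated with the subgroups $\alpha^{-1}(\mathcal{E}_{\rm EVEN})$ and $\theta^{-1}(\mathcal{E}_{\rm EVEN})$ are irreducible.
   Context: For a subgroup $H$ of a (discrete) group $G$, the quasi-regular representation of $G$ associated with $H$ is the unitary representation of $G$ on $\ell^2(G/H)$ by left translations. Thompson's group $F$ is the group of piecewise linear homeomorphisms of $[0,1]$ differentiable except at finitely many dyadic rationals, with all slopes powers of $2$; the product is $(f\cdot g)(t)=g(f(t))$ (words in generators are read with this convention). $F$ is generated by $x_0,x_1$, where in binary expansions $x_0$ is $.00\alpha\mapsto .0\alpha$, $.01\alpha\mapsto .10\alpha$, $.1\alpha\mapsto .11\alpha$, and $x_1$ is the identity on $[0,1/2]$ and $.1\beta\mapsto .1\,x_0(\beta)$ on $[1/2,1]$ (i.e. $.100\alpha\mapsto .10\alpha$, $.101\alpha\mapsto .110\alpha$, $.11\alpha\mapsto .111\alpha$). For positive integers $a,b$, $K_{(a,b)}=\{f\in F: \log_2 f'(0)\in a\mathbb{Z},\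 \log_2 f'(1)\in b\mathbb{Z}\}$. It is known (from earlier work) that $\alpha$ and $\theta$ are well-defined isomorphisms. Tree diagrams: a tree diagram is a pair $(T_+,T_-)$ of finite planar rooted binary trees with the same number $n$ of leaves. Vertices are finite binary words (root = empty word, $v0$ and $v1$ = left and right child of $v$). It represents the element of $F$ sending $.\alpha_k\gamma$ to $.\beta_k\gamma$ for each $k$ and each infinite binary word $\gamma$, where $\alpha_k,\beta_k$ are the $k$-th leaves (from left to right) of $T_+,T_-$. Every element of $F$ is so represented, uniquely up to inserting/deleting pairs of opposing carets. One draws $T_-$ upside down below $T_+$ and identifies the $k$-th leaves of the two trees. Planar $3$-colorable subgroup $\mathcal{E}$: ignoring edges sprouting upward/downward from the two roots, the diagram partitions the plane into regions: the outer region $R_0=R_n$ and, for $1\le i\le n-1$, the region $R_i$ between the $i$-th and $(i+1)$-th leaves. If $v$ is a non-root vertex of $T_+$ or $T_-$ whose descendant leaves are numbers $p+1,\dots,q$, the edge from $v$ to its parent separates $R_p$ from $R_q$. $\mathcal{E}$ is the subgroup of elements whose plane partition is $3$-colorable: there is a map $c$ from the regions to $\mathbb{Z}_3$ giving different colors to regions sharing an edge, i.e. $c(R_p)\neq c(R_q)$ for each such $v$. This does not depend on the tree diagram chosen. *)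

theory Defs
  imports
    "HOL-Analysis.Analysis"
    "HOL-Algebra.Left_Coset"
    "HOL-Library.Stream"
    "HOL-Library.Sublist"
    "HOL-Library.Numeral_Type"
begin

section \<open>Quasi-regular representations\<close>

text \<open>Vectors of \<open>\<ell>\<^sup>2(X)\<close> are functions on the whole type that vanish off \<open>X\<close>, so that equality in
  \<open>\<ell>\<^sup>2(X)\<close> is equality of functions.\<close>

definition ell2 :: "'a set \<Rightarrow> ('a \<Rightarrow> complex) set" where
  "ell2 X = {\<xi>. (\<forall>x. x \<notin> X \<longrightarrow> \<xi> x = 0) \<and> (\<lambda>x. (cmod (\<xi> x))\<^sup>2) summable_on X}"

definition ell2_norm :: "'a set \<Rightarrow> ('a \<Rightarrow> complex) \<Rightarrow> real" where
  "ell2_norm X \<xi> = sqrt (\<Sum>\<^sub>\<infinity>x\<in>X. (cmod (\<xi> x))\<^sup>2)"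

definition ell2_closed_subspace :: "'a set \<Rightarrow> ('a \<Rightarrow> complex) set \<Rightarrow> bool" where
  "ell2_closed_subspace X W \<longleftrightarrow>
     W \<subseteq> ell2 X \<and> (\<lambda>_. 0) \<in> W \<and>
     (\<forall>\<xi>\<in>W. \<forall>\<eta>\<in>W. (\<lambda>x. \<xi> x + \<eta> x) \<in> W) \<and>
     (\<forall>a. \<forall>\<xi>\<in>W. (\<lambda>x. a * \<xi> x) \<in> W) \<and>
     (\<forall>s. \<forall>\<xi>\<in>ell2 X. (\<forall>n::nat. s n \<in> W) \<and>
        (\<lambda>n. ell2_norm X (\<lambda>x. s n x - \<xi> x)) \<longlonglongrightarrow> 0 \<longrightarrow> \<xi> \<in> W)"

definition irreducible_on_ell2 ::
    "('g, 'm) monoid_scheme \<Rightarrow> 'a set \<Rightarrow> ('g \<Rightarrow> ('a \<Rightarrow> complex) \<Rightarrow> ('a \<Rightarrow> complex)) \<Rightarrow> bool" where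
  "irreducible_on_ell2 G X \<pi> \<longleftrightarrow>
     ell2 X \<noteq> {\<lambda>_. 0} \<and>
     (\<forall>W. ell2_closed_subspace X W \<and> (\<forall>g\<in>carrier G. \<forall>\<xi>\<in>W. \<pi> g \<xi> \<in> W)
        \<longrightarrow> W = {\<lambda>_. 0} \<or> W = ell2 X)"

definition quasi_regular ::
    "('g, 'm) monoid_scheme \<Rightarrow> 'g set \<Rightarrow> 'g \<Rightarrow> ('g set \<Rightarrow> complex) \<Rightarrow> ('g set \<Rightarrow> complex)" where
  "quasi_regular G H g \<xi> =
     (\<lambda>C. if C \<in> lcosets\<^bsub>G\<^esub> H then \<xi> ((inv\<^bsub>G\<^esub> g) <#\<^bsub>G\<^esub> C) else 0)"

definition quasi_regular_irreducible :: "('g, 'm) monoid_scheme \<Rightarrow> 'g set \<Rightarrow> bool" where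
  "quasi_regular_irreducible G H \<longleftrightarrow>
     irreducible_on_ell2 G (lcosets\<^bsub>G\<^esub> H) (quasi_regular G H)"


section \<open>Thompson's group F\<close>

definition dyadic_rationals :: "real set" where
  "dyadic_rationals = {of_int m / 2 ^ n | (m::int) (n::nat). True}"

text \<open>Elements are functions on \<open>[0,1]\<close>, made total in the extensional way. The set \<open>D\<close> contains the
  points of non-differentiability: on any interval without a point of \<open>D\<close> in its interior, the map
  is affine with slope a power of \<open>2\<close>.\<close>

definition thompson_F_maps :: "(real \<Rightarrow> real) set" where
  "thompson_F_maps = {f \<in> extensional {0..1}.
     (\<exists>g. homeomorphism {0..1} {0..1} f g) \<and>
     (\<exists>D. finite D \<and> D \<subseteq> dyadic_rationals \<and>
        (\<forall>a b. 0 \<le> a \<and> a < b \<and> b \<le> 1 \<and> {a<..<b} \<inter> D = {} \<longrightarrow>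
           (\<exists>(k::int) c. \<forall>x\<in>{a..b}. f x = 2 powi k * x + c)))}"

text \<open>The product is written in the order of application, \<open>(f \<cdot> g)(t) = g (f t)\<close>.\<close>

definition thompson_F :: "(real \<Rightarrow> real) monoid" where
  "thompson_F = \<lparr>carrier = thompson_F_maps, mult = (\<lambda>f g. compose {0..1} g f),
     one = (\<lambda>x\<in>{0..1}. x)\<rparr>"

text \<open>In binary expansions \<open>x\<^sub>0\<close> is \<open>.00\<gamma> \<mapsto> .0\<gamma>\<close>, \<open>.01\<gamma> \<mapsto> .10\<gamma>\<close>,
  \<open>.1\<gamma> \<mapsto> .11\<gamma>\<close>, and \<open>x\<^sub>1\<close> is \<open>.1\<gamma> \<mapsto> .1 x\<^sub>0(\<gamma>)\<close> on \<open>[1/2,1]\<close>.\<close>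

definition thompson_x0 :: "real \<Rightarrow> real" where
  "thompson_x0 = (\<lambda>t\<in>{0..1}. if t \<le> 1/4 then 2 * t
                       else if t \<le> 1/2 then t + 1/4
                       else (t + 1) / 2)"

definition thompson_x1 :: "real \<Rightarrow> real" where
  "thompson_x1 = (\<lambda>t\<in>{0..1}. if t \<le> 1/2 then t else 1/2 + thompson_x0 (2 * t - 1) / 2)"

definition thompson_K :: "nat \<Rightarrow> nat \<Rightarrow> (real \<Rightarrow> real) set" where
  "thompson_K a b = {f \<in> carrier thompson_F.
     (\<exists>d. (f has_real_derivative d) (at 0 within {0..1}) \<and> (\<exists>k::int. log 2 d = real a * of_int k)) \<and>
     (\<exists>d. (f has_real_derivative d) (at 1 within {0..1}) \<and> (\<exists>k::int. log 2 d = real b * of_int k))}"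


section \<open>Tree diagrams\<close>

text \<open>In a diagram \<open>(Tp, Tm)\<close> the tree \<open>Tp\<close> is the domain tree and \<open>Tm\<close> the range tree.
  Vertices are binary words; \<open>False\<close> is the digit \<open>0\<close> (left) and \<open>True\<close> the digit \<open>1\<close> (right).\<close>

datatype bintree = Leaf | Caret bintree bintree

fun vertices :: "bintree \<Rightarrow> bool list set" where
  "vertices Leaf = {[]}"
| "vertices (Caret l r) = {[]} \<union> (Cons False) ` vertices l \<union> (Cons True) ` vertices r"

fun leaves :: "bintree \<Rightarrow> bool list list" where
  "leaves Leaf = [[]]"
| "leaves (Caret l r) = map (Cons False) (leaves l) @ map (Cons True) (leaves r)"

definition binary_value :: "bool stream \<Rightarrow> real" where
  "binary_value \<gamma> = (\<Sum>i. of_bool (\<gamma> !! i) / 2 ^ Suc i)"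

definition tree_diagram_of :: "bintree \<Rightarrow> bintree \<Rightarrow> (real \<Rightarrow> real) \<Rightarrow> bool" where
  "tree_diagram_of Tp Tm f \<longleftrightarrow>
     length (leaves Tp) = length (leaves Tm) \<and>
     (\<forall>k < length (leaves Tp). \<forall>\<gamma>.
        f (binary_value (leaves Tp ! k @- \<gamma>)) = binary_value (leaves Tm ! k @- \<gamma>))"

text \<open>Lists are indexed from \<open>0\<close>, so the leaves numbered \<open>p+1, \<dots>, q\<close> in the drawing have list
  indices \<open>p, \<dots>, q-1\<close>.\<close>

definition edge_separates :: "bintree \<Rightarrow> bool list \<Rightarrow> nat \<Rightarrow> nat \<Rightarrow> bool" where
  "edge_separates T v p q \<longleftrightarrow>
     v \<in> vertices T \<and> v \<noteq> [] \<and> p < q \<and>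
     {k. k < length (leaves T) \<and> prefix v (leaves T ! k)} = {p..<q}"

text \<open>The numeral type \<open>3\<close> is the ring of integers modulo \<open>3\<close>. A coloring of the regions
  \<open>R\<^sub>0, \<dots>, R\<^sub>n\<close> must respect \<open>R\<^sub>0 = R\<^sub>n\<close>.\<close>

definition three_colorable :: "bintree \<Rightarrow> bintree \<Rightarrow> bool" where
  "three_colorable Tp Tm \<longleftrightarrow>
     (\<exists>c :: nat \<Rightarrow> 3. c 0 = c (length (leaves Tp)) \<and>
        (\<forall>v p q. edge_separates Tp v p q \<or> edge_separates Tm v p q \<longrightarrow> c p \<noteq> c q))"

definition planar_3_colorable_subgroup :: "(real \<Rightarrow> real) set" where
  "planar_3_colorable_subgroup = {f \<in> carrier thompson_F.
     \<exists>Tp Tm. tree_diagram_of Tp Tm f \<and> three_colorable Tp Tm}"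

definition planar_3_colorable_even :: "(real \<Rightarrow> real) set" where
  "planar_3_colorable_even = planar_3_colorable_subgroup \<inter> thompson_K 2 2"

end

theory Submission
  imports Defs "HOL-Real_Asymp.Real_Asymp"
begin

text \<open>If some \<open>h \<in> H\<close> has infinite orbits on \<open>G/H\<close> except for the base point, then the averages of
  the translates of a vector \<open>\<xi>\<close> by powers of \<open>h\<close> converge to \<open>\<xi> H * delta H\<close>. Hence a nonzero
  closed invariant subspace contains \<open>delta H\<close>, and the quasi-regular representation is irreducible.

  A 3-coloring of a tree diagram is determined by the differences of adjacent colors. At the leaf
  \<open>w\<close> this difference is, up to a global sign for each tree, \<open>(-1)\<close> to the power \<open>length w\<close>, with
  another sign according to the half of \<open>[0,1]\<close> containing \<open>w\<close>. The even part of the planar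
  3-colorable subgroup therefore consists of all \<open>f\<close> whose slope \<open>2\<^sup>k\<close> at \<open>x\<close> has \<open>k\<close> even exactly if
  \<open>x\<close> and \<open>f x\<close> lie on the same side of \<open>1/2\<close>, that is, of the kernel of a cocycle. It contains an
  element \<open>push\<close> with \<open>push x < x\<close> on \<open>(0,1)\<close>. If a conjugate of a power of \<open>push\<close> by \<open>g\<close> is again in
  it, then the cocycle of \<open>g\<close> is invariant under that power, hence constant, as the iterates tend
  to \<open>0\<close>. The constant is the value at \<open>0\<close>, which is trivial for \<open>g\<close> with an even slope exponent at \<open>0\<close>.\<close>

section \<open>Irreducibility of quasi-regular representations\<close>

text \<open>Restricting to the range of \<alpha> or \<theta> is essential. In
  \<open>thompson_F\<close> itself, \<open>thompson_x0\<close> has an odd slope exponent exactly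
  where it stays on one side of 1/2, so its cocycle is constantly nontrivial: it normalizes the even
  part without lying in it. Right translation by it commutes with all left translations of cosets,
  and the quasi-regular representation of F on the cosets of the even part is reducible. An element
  with this constant value has an odd exponent at 0, and \<open>thompson_K 2 b\<close> excludes
  exactly that.

  The condition on orbits is a cyclic form of Mackey's criterion, by which a subgroup equal to its
  own commensurator has an irreducible quasi-regular representation. One element h serves all cosets
  at once, so explicit averages over its powers converge in norm.\<close>

text \<open>Bounding the norms over finite sets gives membership and the norm bound at once. All
  estimates below are thereby reduced to \<open>L2_set\<close>, where Minkowski's inequality is
  available.\<close>

lemma ell2I:
  assumes "\<And>x. x \<notin> X \<Longrightarrow> \<xi> x = 0"
    and "\<And>A. finite A \<Longrightarrow> A \<subseteq> X \<Longrightarrow> L2_set (\<lambda>x. cmod (\<xi> x)) A \<le> B"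
  shows "\<xi> \<in> ell2 X" "ell2_norm X \<xi> \<le> B"
proof -
  have B0: "0 \<le> B" using assms(2)[of "{}"] by simp
  have le: "(\<Sum>x\<in>A. (cmod (\<xi> x))\<^sup>2) \<le> B\<^sup>2" if "finite A" "A \<subseteq> X" for A
  proof -
    have "sqrt (\<Sum>x\<in>A. (cmod (\<xi> x))\<^sup>2) \<le> B"
      using assms(2)[OF that] by (simp add: L2_set_def)
    thus ?thesis by (simp add: sqrt_le_D)
  qed
  have s: "(\<lambda>x. (cmod (\<xi> x))\<^sup>2) summable_on X"
    by (rule nonneg_bdd_above_summable_on) (auto intro!: bdd_aboveI2[where M="B\<^sup>2"] le)
  thus "\<xi> \<in> ell2 X" using assms(1) by (simp add: ell2_def)
  have "(\<Sum>\<^sub>\<infinity>x\<in>X. (cmod (\<xi> x))\<^sup>2) \<le> B\<^sup>2"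
    by (rule infsum_le_finite_sums[OF s]) (use le in auto)
  thus "ell2_norm X \<xi> \<le> B"
    unfolding ell2_norm_def using B0 real_le_lsqrt by blast
qed

lemma ell2_zero_outside: "\<xi> \<in> ell2 X \<Longrightarrow> x \<notin> X \<Longrightarrow> \<xi> x = 0"
  by (simp add: ell2_def)

lemma L2_set_le_ell2_norm:
  assumes "\<xi> \<in> ell2 X" "finite A" "A \<subseteq> X"
  shows "L2_set (\<lambda>x. cmod (\<xi> x)) A \<le> ell2_norm X \<xi>"
  unfolding L2_set_def ell2_norm_def
  by (rule real_sqrt_le_mono, rule finite_sum_le_infsum) (use assms in \<open>auto simp: ell2_def\<close>)

lemma ell2_norm_nonneg: "0 \<le> ell2_norm X \<xi>"
  by (auto simp: ell2_norm_def intro!: infsum_nonneg)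

lemma ell2_zero: "(\<lambda>_. 0) \<in> ell2 X" "ell2_norm X (\<lambda>_. 0) = 0"
  by (auto simp: ell2_def ell2_norm_def)

lemma ell2_add:
  assumes "\<xi> \<in> ell2 X" "\<eta> \<in> ell2 X"
  shows "(\<lambda>x. \<xi> x + \<eta> x) \<in> ell2 X"
    and "ell2_norm X (\<lambda>x. \<xi> x + \<eta> x) \<le> ell2_norm X \<xi> + ell2_norm X \<eta>"
proof -
  have le: "L2_set (\<lambda>x. cmod (\<xi> x + \<eta> x)) A \<le> ell2_norm X \<xi> + ell2_norm X \<eta>"
    if "finite A" "A \<subseteq> X" for A
  proof -
    have "L2_set (\<lambda>x. cmod (\<xi> x + \<eta> x)) A \<le> L2_set (\<lambda>x. cmod (\<xi> x) + cmod (\<eta> x)) A"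
      by (rule L2_set_mono) (auto simp: norm_triangle_ineq)
    also have "\<dots> \<le> L2_set (\<lambda>x. cmod (\<xi> x)) A + L2_set (\<lambda>x. cmod (\<eta> x)) A"
      by (rule L2_set_triangle_ineq)
    also have "\<dots> \<le> ell2_norm X \<xi> + ell2_norm X \<eta>"
      using that assms by (intro add_mono L2_set_le_ell2_norm)
    finally show ?thesis .
  qed
  show "(\<lambda>x. \<xi> x + \<eta> x) \<in> ell2 X"
    "ell2_norm X (\<lambda>x. \<xi> x + \<eta> x) \<le> ell2_norm X \<xi> + ell2_norm X \<eta>"
    by (rule ell2I[OF _ le]; simp add: assms[THEN ell2_zero_outside])+
qed

lemma ell2_scale:
  assumes "\<xi> \<in> ell2 X"
  shows "(\<lambda>x. a * \<xi> x) \<in> ell2 X"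
    and "ell2_norm X (\<lambda>x. a * \<xi> x) \<le> cmod a * ell2_norm X \<xi>"
proof -
  have le: "L2_set (\<lambda>x. cmod (a * \<xi> x)) A \<le> cmod a * ell2_norm X \<xi>"
    if "finite A" "A \<subseteq> X" for A
    using L2_set_le_ell2_norm[OF assms that]
    by (simp add: norm_mult mult_left_mono flip: L2_set_right_distrib)
  show "(\<lambda>x. a * \<xi> x) \<in> ell2 X" "ell2_norm X (\<lambda>x. a * \<xi> x) \<le> cmod a * ell2_norm X \<xi>"
    by (rule ell2I[OF _ le]; simp add: assms[THEN ell2_zero_outside])+
qed

lemma ell2_sum:
  assumes "finite I" "\<And>i. i \<in> I \<Longrightarrow> f i \<in> ell2 X"
  shows "(\<lambda>x. \<Sum>i\<in>I. f i x) \<in> ell2 X \<and>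
    ell2_norm X (\<lambda>x. \<Sum>i\<in>I. f i x) \<le> (\<Sum>i\<in>I. ell2_norm X (f i))"
  using assms
proof (induction I rule: finite_induct)
  case empty
  then show ?case by (simp add: ell2_zero)
next
  case (insert i I)
  then have "f i \<in> ell2 X" and *: "(\<lambda>x. \<Sum>i\<in>I. f i x) \<in> ell2 X"
    "ell2_norm X (\<lambda>x. \<Sum>i\<in>I. f i x) \<le> (\<Sum>i\<in>I. ell2_norm X (f i))" by auto
  from ell2_add[OF this(1,2)] *(2) insert show ?case by auto
qed

lemma ell2_pullback:
  assumes "\<xi> \<in> ell2 X" "inj_on \<phi> X" "\<phi> ` X \<subseteq> X"
  shows "(\<lambda>x. if x \<in> X then \<xi> (\<phi> x) else 0) \<in> ell2 X"
    and "ell2_norm X (\<lambda>x. if x \<in> X then \<xi> (\<phi> x) else 0) \<le> ell2_norm X \<xi>"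
proof -
  have le: "L2_set (\<lambda>x. cmod (if x \<in> X then \<xi> (\<phi> x) else 0)) A \<le> ell2_norm X \<xi>"
    if "finite A" "A \<subseteq> X" for A
  proof -
    have "L2_set (\<lambda>x. cmod (if x \<in> X then \<xi> (\<phi> x) else 0)) A = L2_set (\<lambda>x. cmod (\<xi> (\<phi> x))) A"
      using that by (intro L2_set_cong) auto
    also have "\<dots> = L2_set (\<lambda>x. cmod (\<xi> x)) (\<phi> ` A)"
      using inj_on_subset[OF assms(2) that(2)] by (simp add: L2_set_def sum.reindex)
    also have "\<dots> \<le> ell2_norm X \<xi>"
      using that assms by (intro L2_set_le_ell2_norm) auto
    finally show ?thesis .
  qed
  show "(\<lambda>x. if x \<in> X then \<xi> (\<phi> x) else 0) \<in> ell2 X"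
    "ell2_norm X (\<lambda>x. if x \<in> X then \<xi> (\<phi> x) else 0) \<le> ell2_norm X \<xi>"
    by (rule ell2I; use le in auto)+
qed

definition delta :: "'a \<Rightarrow> 'a \<Rightarrow> complex" where
  "delta y x = (if x = y then 1 else 0)"

lemma delta_in_ell2: "y \<in> X \<Longrightarrow> delta y \<in> ell2 X"
proof (rule ell2I[where B = 1])
  fix A :: "'a set" assume "finite A"
  have "L2_set (\<lambda>x. cmod (delta y x)) A \<le> (\<Sum>x\<in>A. cmod (delta y x))"
    by (rule L2_set_le_sum) auto
  also have "\<dots> \<le> 1" using \<open>finite A\<close> by (simp add: delta_def if_distrib cong: if_cong)
  finally show "L2_set (\<lambda>x. cmod (delta y x)) A \<le> 1" .
qed (auto simp: delta_def)

lemma ell2_finite_approx: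
  assumes "\<xi> \<in> ell2 X" "0 < \<epsilon>"
  obtains A where "finite A" "A \<subseteq> X" "(\<lambda>x. if x \<in> A then 0 else \<xi> x) \<in> ell2 X"
    "ell2_norm X (\<lambda>x. if x \<in> A then 0 else \<xi> x) < \<epsilon>"
proof -
  let ?f = "\<lambda>x. (cmod (\<xi> x))\<^sup>2"
  have s: "?f summable_on X" using assms by (simp add: ell2_def)
  \<comment> \<open>Half of \<epsilon> turns the non-strict bound produced by \<open>ell2I\<close>
    into a strict one.\<close>
  obtain A where A: "finite A" "A \<subseteq> X" "dist (sum ?f A) (infsum ?f X) \<le> (\<epsilon>/2)\<^sup>2"
    using infsum_finite_approximation[OF s, of "(\<epsilon>/2)\<^sup>2"] assms(2) by auto
  have le: "L2_set (\<lambda>x. cmod (if x \<in> A then 0 else \<xi> x)) B \<le> \<epsilon>/2" if B: "finite B" "B \<subseteq> X" for B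
  proof -
    have "(\<Sum>x\<in>B. (cmod (if x \<in> A then 0 else \<xi> x))\<^sup>2) = (\<Sum>x\<in>B - A. ?f x)"
      using B by (intro sum.mono_neutral_cong_right) auto
    also have "\<dots> = sum ?f (A \<union> (B - A)) - sum ?f A"
      using A B by (subst sum.union_disjoint) auto
    also have "\<dots> \<le> infsum ?f X - sum ?f A"
      using A B s by (intro diff_right_mono finite_sum_le_infsum) auto
    also have "\<dots> \<le> (\<epsilon>/2)\<^sup>2" using A(3) by (simp add: dist_real_def)
    finally show ?thesis unfolding L2_set_def using assms(2) by (intro real_le_lsqrt) auto
  qed
  have "(\<lambda>x. if x \<in> A then 0 else \<xi> x) \<in> ell2 X"
    "ell2_norm X (\<lambda>x. if x \<in> A then 0 else \<xi> x) \<le> \<epsilon>/2"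
    using ell2_zero_outside[OF assms(1)] A(2) le
    by (auto intro!: ell2I[where X = X] simp del: le_divide_eq_numeral1)
  with A assms(2) that show ?thesis by force
qed

section \<open>Averages along the iterates of an injection\<close>

lemma funpow_mem: "\<phi> ` X \<subseteq> X \<Longrightarrow> x \<in> X \<Longrightarrow> (\<phi> ^^ n) x \<in> X"
  by (induction n) auto

lemma inj_on_funpow:
  assumes "inj_on \<phi> X" "\<phi> ` X \<subseteq> X" shows "inj_on (\<phi> ^^ n) X"
proof (induction n)
  case (Suc n)
  show ?case unfolding inj_on_def
  proof (intro ballI impI)
    fix u v assume uv: "u \<in> X" "v \<in> X" "(\<phi> ^^ Suc n) u = (\<phi> ^^ Suc n) v"
    hence "(\<phi> ^^ n) u = (\<phi> ^^ n) v" using assms funpow_mem[OF assms(2)] by (auto dest: inj_onD)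
    thus "u = v" using Suc uv by (auto dest: inj_onD)
  qed
qed auto

text \<open>The orbit of y never returns, so each x reaches y at most once. The average thus has
  absolute value at most 1/N, on at most N points, and its squared norm is at most N *
  (1/N)^2.\<close>

lemma ergodic_average_delta:
  assumes inj: "inj_on \<phi> X" and into: "\<phi> ` X \<subseteq> X"
    and free: "\<And>n. 0 < n \<Longrightarrow> (\<phi> ^^ n) y \<noteq> y"
  defines "a \<equiv> \<lambda>N x. if x \<in> X then (\<Sum>n<N. delta y ((\<phi> ^^ n) x)) / of_nat N else 0"
  shows "a N \<in> ell2 X" "ell2_norm X (a N) \<le> 1 / sqrt N"
proof -
  note inj_n = inj_on_funpow[OF inj into]
  have uniq: "m = n" if "x \<in> X" "(\<phi> ^^ m) x = y" "(\<phi> ^^ n) x = y" for x m n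
  proof (rule ccontr)
    assume "m \<noteq> n"
    have *: False if "p < q" "(\<phi> ^^ p) x = y" "(\<phi> ^^ q) x = y" for p q
    proof -
      have "(\<phi> ^^ (q - p)) y = (\<phi> ^^ (q - p + p)) x" using that(2) by (simp add: funpow_add)
      also have "\<dots> = y" using that by simp
      finally show False using free[of "q - p"] that(1) by simp
    qed
    show False using *[of m n] *[of n m] \<open>m \<noteq> n\<close> that by linarith
  qed
  have val: "cmod (a N x) \<le> (if \<exists>n<N. (\<phi> ^^ n) x = y then 1 / N else 0)" if x: "x \<in> X" for x
  proof (cases "\<exists>n<N. (\<phi> ^^ n) x = y")
    case True
    then obtain n where n: "n < N" "(\<phi> ^^ n) x = y" by blast
    have "(\<phi> ^^ k) x = y \<longleftrightarrow> k = n" for k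
      using n(2) uniq[OF x] by blast
    hence "(\<Sum>k<N. delta y ((\<phi> ^^ k) x)) = (\<Sum>k<N. if k = n then 1 else 0)"
      by (simp add: delta_def)
    also have "\<dots> = 1" using n by simp
    finally show ?thesis using x True by (simp add: a_def norm_divide)
  next
    case False
    hence "\<forall>k\<in>{..<N}. delta y ((\<phi> ^^ k) x) = 0"
      unfolding delta_def lessThan_iff Ball_def by metis
    hence "a N x = 0" unfolding a_def using sum.neutral by fastforce
    thus ?thesis by simp
  qed
  have le: "L2_set (\<lambda>x. cmod (a N x)) A \<le> 1 / sqrt N" if A: "finite A" "A \<subseteq> X" for A
  proof -
    let ?S = "{x \<in> A. \<exists>n<N. (\<phi> ^^ n) x = y}"
    have "\<forall>x\<in>?S. \<exists>n. n < N \<and> (\<phi> ^^ n) x = y" by blast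
    then obtain t where t: "\<And>x. x \<in> ?S \<Longrightarrow> t x < N \<and> (\<phi> ^^ t x) x = y"
      by (elim bchoice[THEN exE]) blast
    \<comment> \<open>The hitting time t is injective on ?S: two points that reach y at the same
      time agree, because the iterates of \<phi> are injective.\<close>
    have "card ?S \<le> card {..<N}"
    proof (rule card_inj_on_le)
      show "inj_on t ?S"
      proof (rule inj_onI)
        fix u v assume uv: "u \<in> ?S" "v \<in> ?S" "t u = t v"
        have "(\<phi> ^^ t u) u = (\<phi> ^^ t u) v"
          using t[OF uv(1)] t[OF uv(2)] unfolding uv(3) by metis
        moreover have "u \<in> X" "v \<in> X" using uv A by auto
        ultimately show "u = v" by (rule inj_onD[OF inj_n])
      qed
      show "t ` ?S \<subseteq> {..<N}" using t by auto
    qed auto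
    hence card: "real (card ?S) \<le> N" by simp
    have "(\<Sum>x\<in>A. (cmod (a N x))\<^sup>2) \<le> (\<Sum>x\<in>A. if \<exists>n<N. (\<phi> ^^ n) x = y then (1 / N)\<^sup>2 else 0)"
    proof (rule sum_mono)
      fix x assume "x \<in> A"
      hence "x \<in> X" using A by auto
      from val[OF this] have "(cmod (a N x))\<^sup>2 \<le> (if \<exists>n<N. (\<phi> ^^ n) x = y then 1 / N else 0)\<^sup>2"
        by (intro power_mono) auto
      thus "(cmod (a N x))\<^sup>2 \<le> (if \<exists>n<N. (\<phi> ^^ n) x = y then (1 / N)\<^sup>2 else 0)"
        by (auto split: if_splits)
    qed
    also have "\<dots> = (\<Sum>x\<in>?S. (1 / N)\<^sup>2)"
      by (rule sum.inter_filter[OF A(1), symmetric])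
    also have "\<dots> = real (card ?S) * (1 / N)\<^sup>2" by simp
    also have "\<dots> \<le> N * (1 / N)\<^sup>2" by (intro mult_right_mono card) auto
    also have "\<dots> = 1 / N" by (simp add: power2_eq_square)
    finally have "L2_set (\<lambda>x. cmod (a N x)) A \<le> sqrt (1 / N)"
      unfolding L2_set_def by (rule real_sqrt_le_mono)
    thus ?thesis by (simp add: real_sqrt_divide)
  qed
  show "a N \<in> ell2 X" "ell2_norm X (a N) \<le> 1 / sqrt N"
    by (rule ell2I; use le in \<open>auto simp: a_def\<close>)+
qed

text \<open>Von Neumann's ergodic theorem in the case where every orbit except the fixed point \<open>x0\<close> is
  infinite, so that only multiples of \<open>delta x0\<close> are invariant.\<close>

lemma ergodic_average_tendsto:
  assumes inj: "inj_on \<phi> X" and into: "\<phi> ` X \<subseteq> X" and x0: "x0 \<in> X" "\<phi> x0 = x0"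
    and free: "\<And>x n. x \<in> X \<Longrightarrow> x \<noteq> x0 \<Longrightarrow> 0 < n \<Longrightarrow> (\<phi> ^^ n) x \<noteq> x"
    and \<xi>: "\<xi> \<in> ell2 X"
  shows "(\<lambda>N. ell2_norm X (\<lambda>x. (if x \<in> X then (\<Sum>n<Suc N. \<xi> ((\<phi> ^^ n) x)) / of_nat (Suc N) else 0)
    - \<xi> x0 * delta x0 x)) \<longlonglongrightarrow> 0"
proof (rule LIMSEQ_I)
  fix r :: real assume r: "0 < r"
  note into_n = funpow_mem[OF into] and inj_n = inj_on_funpow[OF inj into]
  have fix_n: "(\<phi> ^^ n) x0 = x0" for n using x0 by (induction n) auto
  define avg where "avg = (\<lambda>(\<zeta> :: _ \<Rightarrow> complex) N x. if x \<in> X then (\<Sum>n<N. \<zeta> ((\<phi> ^^ n) x)) / of_nat N else 0)"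
  \<comment> \<open>By injectivity no other point enters x0, so averaging leaves
    \<open>delta x0\<close> unchanged.\<close>
  have nonfix: "(\<phi> ^^ n) x \<noteq> x0" if "x \<in> X" "x \<noteq> x0" for n x
    using inj_n[of n] that x0 fix_n[of n] by (metis inj_onD)
  obtain A where A: "finite A" "A \<subseteq> X" "(\<lambda>x. if x \<in> A then 0 else \<xi> x) \<in> ell2 X"
    and Ar: "ell2_norm X (\<lambda>x. if x \<in> A then 0 else \<xi> x) < r / 2"
    using ell2_finite_approx[OF \<xi>, of "r/2"] r by auto
  \<comment> \<open>Removing x0 besides A splits \<xi> into three parts: the small tail \<zeta>,
    finitely many deltas at points with infinite orbits, and the multiple of \<open>delta x0\<close>
    that survives.\<close>
  define \<zeta> where "\<zeta> = (\<lambda>x. if x \<in> insert x0 A then 0 else \<xi> x)"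
  have \<zeta>_le: "L2_set (\<lambda>x. cmod (\<zeta> x)) B \<le> ell2_norm X (\<lambda>x. if x \<in> A then 0 else \<xi> x)"
    if "finite B" "B \<subseteq> X" for B
  proof -
    have "L2_set (\<lambda>x. cmod (\<zeta> x)) B \<le> L2_set (\<lambda>x. cmod (if x \<in> A then 0 else \<xi> x)) B"
      by (rule L2_set_mono) (auto simp: \<zeta>_def)
    also have "\<dots> \<le> ell2_norm X (\<lambda>x. if x \<in> A then 0 else \<xi> x)"
      using that A by (intro L2_set_le_ell2_norm) auto
    finally show ?thesis .
  qed
  have \<zeta>: "\<zeta> \<in> ell2 X" "ell2_norm X \<zeta> \<le> ell2_norm X (\<lambda>x. if x \<in> A then 0 else \<xi> x)"
    by (rule ell2I; use \<zeta>_le ell2_zero_outside[OF \<xi>] in \<open>auto simp: \<zeta>_def\<close>)+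
  define M where "M = (\<Sum>y\<in>A - {x0}. cmod (\<xi> y))"
  have M0: "0 \<le> M" by (auto simp: M_def intro: sum_nonneg)
  \<comment> \<open>Averaging does not increase the norm of the tail, which gives r/2. Each delta at
    y in A - {x0} contributes at most \<open>cmod (\<xi> y) / sqrt N\<close>, which sums to M / sqrt
    N.\<close>
  have bound: "ell2_norm X (\<lambda>x. avg \<xi> N x - \<xi> x0 * delta x0 x) < r / 2 + M / sqrt N"
    if N: "0 < N" for N
  proof -
    have avg\<zeta>_eq: "avg \<zeta> N = (\<lambda>x. (1 / of_nat N) * (\<Sum>n<N. (if x \<in> X then \<zeta> ((\<phi> ^^ n) x) else 0)))"
      by (auto simp: avg_def fun_eq_iff)
    have pull: "(\<lambda>x. if x \<in> X then \<zeta> ((\<phi> ^^ n) x) else 0) \<in> ell2 X"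
        "ell2_norm X (\<lambda>x. if x \<in> X then \<zeta> ((\<phi> ^^ n) x) else 0) \<le> ell2_norm X \<zeta>" for n
      using ell2_pullback[OF \<zeta>(1) inj_n[of n]] into_n by auto
    have s: "(\<lambda>x. \<Sum>n<N. (if x \<in> X then \<zeta> ((\<phi> ^^ n) x) else 0)) \<in> ell2 X"
        "ell2_norm X (\<lambda>x. \<Sum>n<N. (if x \<in> X then \<zeta> ((\<phi> ^^ n) x) else 0)) \<le> (\<Sum>n<N. ell2_norm X \<zeta>)"
    proof -
      have *: "(\<lambda>x. \<Sum>n<N. (if x \<in> X then \<zeta> ((\<phi> ^^ n) x) else 0)) \<in> ell2 X \<and>
        ell2_norm X (\<lambda>x. \<Sum>n<N. (if x \<in> X then \<zeta> ((\<phi> ^^ n) x) else 0))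
          \<le> (\<Sum>n<N. ell2_norm X (\<lambda>x. if x \<in> X then \<zeta> ((\<phi> ^^ n) x) else 0))"
        by (rule ell2_sum[OF _ pull(1)]) simp
      have "(\<Sum>n<N. ell2_norm X (\<lambda>x. if x \<in> X then \<zeta> ((\<phi> ^^ n) x) else 0)) \<le> (\<Sum>n<N. ell2_norm X \<zeta>)"
        by (rule sum_mono) (rule pull(2))
      with * show "(\<lambda>x. \<Sum>n<N. (if x \<in> X then \<zeta> ((\<phi> ^^ n) x) else 0)) \<in> ell2 X"
        "ell2_norm X (\<lambda>x. \<Sum>n<N. (if x \<in> X then \<zeta> ((\<phi> ^^ n) x) else 0)) \<le> (\<Sum>n<N. ell2_norm X \<zeta>)"
        by linarith+
    qed
    have avg\<zeta>: "avg \<zeta> N \<in> ell2 X" "ell2_norm X (avg \<zeta> N) < r / 2"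
    proof -
      show "avg \<zeta> N \<in> ell2 X" unfolding avg\<zeta>_eq by (rule ell2_scale[OF s(1)])
      have "ell2_norm X (avg \<zeta> N) \<le> cmod (1 / of_nat N) * (\<Sum>n<N. ell2_norm X \<zeta>)"
        unfolding avg\<zeta>_eq using ell2_scale(2)[OF s(1), of "1 / of_nat N"] s(2)
        by (meson mult_left_mono norm_ge_zero order_trans)
      also have "\<dots> = ell2_norm X \<zeta>" using N by (simp add: norm_divide)
      finally show "ell2_norm X (avg \<zeta> N) < r / 2" using \<zeta>(2) Ar by simp
    qed
    let ?b = "\<lambda>y. avg (delta y) N"
    have b: "?b y \<in> ell2 X" "ell2_norm X (?b y) \<le> 1 / sqrt N" if "y \<in> A - {x0}" for y
      using ergodic_average_delta[OF inj into, of y N] free that A unfolding avg_def by auto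
    let ?t = "\<lambda>x. \<Sum>y\<in>A - {x0}. \<xi> y * ?b y x"
    have t: "?t \<in> ell2 X" "ell2_norm X ?t \<le> M / sqrt N"
    proof -
      have "?t \<in> ell2 X \<and> ell2_norm X ?t \<le> (\<Sum>y\<in>A - {x0}. ell2_norm X (\<lambda>x. \<xi> y * ?b y x))"
        using A b by (intro ell2_sum ell2_scale) auto
      moreover have "(\<Sum>y\<in>A - {x0}. ell2_norm X (\<lambda>x. \<xi> y * ?b y x)) \<le> (\<Sum>y\<in>A - {x0}. cmod (\<xi> y) * (1 / sqrt N))"
      proof (rule sum_mono)
        fix y assume y: "y \<in> A - {x0}"
        have "ell2_norm X (\<lambda>x. \<xi> y * ?b y x) \<le> cmod (\<xi> y) * ell2_norm X (?b y)"
          using b[OF y] by (intro ell2_scale) auto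
        also have "\<dots> \<le> cmod (\<xi> y) * (1 / sqrt N)" using b[OF y] by (intro mult_left_mono) auto
        finally show "ell2_norm X (\<lambda>x. \<xi> y * ?b y x) \<le> cmod (\<xi> y) * (1 / sqrt N)" .
      qed
      moreover have "\<dots> = M / sqrt N" by (simp add: M_def sum_divide_distrib)
      ultimately show "?t \<in> ell2 X" "ell2_norm X ?t \<le> M / sqrt N" by auto
    qed
    have "avg \<xi> N x - \<xi> x0 * delta x0 x = avg \<zeta> N x + ?t x" for x
    proof (cases "x \<in> X")
      case True
      have dec: "\<xi> z = \<zeta> z + (\<Sum>y\<in>A - {x0}. \<xi> y * delta y z) + \<xi> x0 * delta x0 z" for z
        using A(1) by (auto simp: \<zeta>_def delta_def if_distrib sum.delta cong: if_cong)
      have d0: "delta x0 ((\<phi> ^^ n) x) = delta x0 x" for n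
        using nonfix[OF True] fix_n by (auto simp: delta_def)
      have "(\<Sum>n<N. \<xi> ((\<phi> ^^ n) x)) = (\<Sum>n<N. \<zeta> ((\<phi> ^^ n) x) + (\<Sum>y\<in>A - {x0}. \<xi> y * delta y ((\<phi> ^^ n) x)) + \<xi> x0 * delta x0 ((\<phi> ^^ n) x))"
        by (rule sum.cong[OF refl], rule dec)
      also have "\<dots> = (\<Sum>n<N. \<zeta> ((\<phi> ^^ n) x)) + (\<Sum>y\<in>A - {x0}. \<xi> y * (\<Sum>n<N. delta y ((\<phi> ^^ n) x)))
          + of_nat N * (\<xi> x0 * delta x0 x)"
        by (simp add: sum.distrib d0 sum_distrib_left sum.swap[of _ "A - {x0}"])
      finally show ?thesis using True N
        by (simp add: avg_def add_divide_distrib sum_divide_distrib[of _ "A - {x0}"])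
    next
      case False
      with x0 show ?thesis by (auto simp: avg_def delta_def)
    qed
    hence "ell2_norm X (\<lambda>x. avg \<xi> N x - \<xi> x0 * delta x0 x) = ell2_norm X (\<lambda>x. avg \<zeta> N x + ?t x)"
      by simp
    also have "\<dots> \<le> ell2_norm X (avg \<zeta> N) + ell2_norm X ?t"
      by (rule ell2_add(2)[OF avg\<zeta>(1) t(1)])
    also have "\<dots> < r / 2 + M / sqrt N" using avg\<zeta>(2) t(2) by linarith
    finally show ?thesis .
  qed
  have "(\<lambda>N. M / sqrt (real (Suc N))) \<longlonglongrightarrow> 0"
    by (rule LIMSEQ_Suc) real_asymp
  then obtain N0 where N0: "\<And>N. N \<ge> N0 \<Longrightarrow> norm (M / sqrt (real (Suc N)) - 0) < r / 2"
    using LIMSEQ_D[of _ 0 "r/2"] r by (metis half_gt_zero)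
  show "\<exists>no. \<forall>N\<ge>no. norm (ell2_norm X (\<lambda>x. (if x \<in> X then (\<Sum>n<Suc N. \<xi> ((\<phi> ^^ n) x)) / of_nat (Suc N) else 0)
    - \<xi> x0 * delta x0 x) - 0) < r"
  proof (intro exI allI impI)
    fix N assume "N0 \<le> N"
    hence "M / sqrt (real (Suc N)) < r / 2" using N0[of N] by (simp only: diff_zero real_norm_def abs_less_iff)
    with bound[of "Suc N"]
    have "ell2_norm X (\<lambda>x. avg \<xi> (Suc N) x - \<xi> x0 * delta x0 x) < r"
      using zero_less_Suc[of N] by linarith
    thus "norm (ell2_norm X (\<lambda>x. (if x \<in> X then (\<Sum>n<Suc N. \<xi> ((\<phi> ^^ n) x)) / of_nat (Suc N) else 0)
    - \<xi> x0 * delta x0 x) - 0) < r"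
      unfolding avg_def by (simp only: diff_zero real_norm_def abs_of_nonneg ell2_norm_nonneg)
  qed
qed

section \<open>From averages to irreducibility\<close>

lemma closed_subspace_eq_ell2:
  assumes W: "ell2_closed_subspace X W" and d: "\<And>y. y \<in> X \<Longrightarrow> delta y \<in> W"
  shows "W = ell2 X"
proof
  show "W \<subseteq> ell2 X" using W by (simp add: ell2_closed_subspace_def)
  have add: "(\<lambda>x. \<xi> x + \<eta> x) \<in> W" if "\<xi> \<in> W" "\<eta> \<in> W" for \<xi> \<eta>
    using W that by (simp add: ell2_closed_subspace_def)
  have sc: "(\<lambda>x. a * \<xi> x) \<in> W" if "\<xi> \<in> W" for \<xi> a
    using W that by (simp add: ell2_closed_subspace_def)
  have fin: "(\<lambda>x. \<Sum>y\<in>A. \<xi> y * delta y x) \<in> W" if "finite A" "A \<subseteq> X" for A and \<xi> :: "_ \<Rightarrow> complex"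
    using that
  proof (induction A rule: finite_induct)
    case empty
    then show ?case using W by (simp add: ell2_closed_subspace_def)
  next
    case (insert y A)
    then show ?case using add[OF sc[OF d[of y]]] by simp
  qed
  show "ell2 X \<subseteq> W"
  proof
    fix \<xi> assume \<xi>: "\<xi> \<in> ell2 X"
    have "\<exists>A. finite A \<and> A \<subseteq> X \<and> (\<lambda>x. if x \<in> A then 0 else \<xi> x) \<in> ell2 X \<and>
      ell2_norm X (\<lambda>x. if x \<in> A then 0 else \<xi> x) < inverse (real (Suc n))" for n
    proof -
      have "0 < inverse (real (Suc n))" by simp
      then obtain A where "finite A" "A \<subseteq> X" "(\<lambda>x. if x \<in> A then 0 else \<xi> x) \<in> ell2 X"
        "ell2_norm X (\<lambda>x. if x \<in> A then 0 else \<xi> x) < inverse (real (Suc n))"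
        by (rule ell2_finite_approx[OF \<xi>])
      thus ?thesis by (intro exI conjI)
    qed
    hence "\<exists>A. \<forall>n. finite (A n) \<and> A n \<subseteq> X \<and> (\<lambda>x. if x \<in> A n then 0 else \<xi> x) \<in> ell2 X \<and>
      ell2_norm X (\<lambda>x. if x \<in> A n then 0 else \<xi> x) < inverse (real (Suc n))"
      by (intro choice allI)
    then obtain A where A: "\<And>n. finite (A n)" "\<And>n. A n \<subseteq> X"
        "\<And>n. (\<lambda>x. if x \<in> A n then 0 else \<xi> x) \<in> ell2 X"
        "\<And>n. ell2_norm X (\<lambda>x. if x \<in> A n then 0 else \<xi> x) < inverse (real (Suc n))"
      by blast
    define s where "s n = (\<lambda>x. \<Sum>y\<in>A n. \<xi> y * delta y x)" for n
    have s: "s n \<in> W" for n unfolding s_def by (rule fin[OF A(1,2)])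
    have seq: "(\<lambda>x. s n x - \<xi> x) = (\<lambda>x. (-1) * (if x \<in> A n then 0 else \<xi> x))" for n
      using A(1)[of n] by (auto simp: s_def delta_def fun_eq_iff if_distrib sum.delta cong: if_cong)
    have "ell2_norm X (\<lambda>x. s n x - \<xi> x) \<le> inverse (real (Suc n))" for n
      unfolding seq using ell2_scale(2)[OF A(3)[of n], of "-1"] A(4)[of n] by simp
    hence "(\<lambda>n. ell2_norm X (\<lambda>x. s n x - \<xi> x)) \<longlonglongrightarrow> 0"
      by (intro tendsto_sandwich[OF _ _ tendsto_const LIMSEQ_inverse_real_of_nat])
        (auto simp: ell2_norm_nonneg)
    with s \<xi> W show "\<xi> \<in> W" unfolding ell2_closed_subspace_def by blast
  qed
qed

text \<open>A power of h fixes the coset of g exactly if its conjugate by g lies in H. The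
  hypothesis \<open>free\<close> therefore says that every coset other than H has an infinite orbit
  under h.\<close>

lemma (in group) quasi_regular_irreducibleI:
  assumes H: "subgroup H G" and h: "h \<in> H"
    and free: "\<And>g n. g \<in> carrier G \<Longrightarrow> g \<notin> H \<Longrightarrow> 0 < n \<Longrightarrow> inv g \<otimes> h [^] (n::nat) \<otimes> g \<notin> H"
  shows "quasi_regular_irreducible G H"
proof -
  \<comment> \<open>The inverse is that of \<open>quasi_regular\<close>: the operator of a power of
    h is composition with the same iterate of ?\<phi>.\<close>
  let ?X = "lcosets H" and ?\<phi> = "\<lambda>C. inv h <# C"
  have HG: "H \<subseteq> carrier G" using H by (rule subgroup.subset)
  have hG: "h \<in> carrier G" using h HG by blast
  have X: "C \<in> ?X \<longleftrightarrow> (\<exists>g\<in>carrier G. C = g <# H)" for C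
    by (auto simp: LCOSETS_def)
  have XG: "C \<subseteq> carrier G" if "C \<in> ?X" for C
    using that l_coset_subset_G[OF HG] unfolding X by auto
  have shift: "g <# C \<in> ?X" if gC: "g \<in> carrier G" "C \<in> ?X" for g C
  proof -
    obtain k where k: "k \<in> carrier G" "C = k <# H" using gC(2) unfolding X by blast
    hence "g <# C = (g \<otimes> k) <# H" using lcos_m_assoc[OF HG gC(1) k(1)] by simp
    with gC(1) k(1) show ?thesis unfolding X by blast
  qed
  have HX: "H \<in> ?X" unfolding X using lcos_mult_one[OF HG] one_closed by metis
  have cancel: "g <# (inv g <# C) = C" "inv g <# (g <# C) = C" if "g \<in> carrier G" "C \<in> ?X" for g C
    using that XG[of C] by (simp_all add: lcos_m_assoc lcos_mult_one)
  have funpow: "(?\<phi> ^^ n) C = inv (h [^] n) <# C" if C: "C \<in> ?X" for n C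
  proof (induction n)
    case 0
    then show ?case using XG[OF C] by (simp add: lcos_mult_one)
  next
    case (Suc n)
    then show ?case using XG[OF C] hG by (simp add: lcos_m_assoc inv_mult_group)
  qed
  have fixH: "g <# H = H" if "g \<in> H" for g
    using coset_join3[OF _ H that] HG that by blast
  have inj: "inj_on ?\<phi> ?X" using cancel(1) hG by (intro inj_onI) metis
  have into: "?\<phi> ` ?X \<subseteq> ?X" using shift hG by auto
  have fx: "?\<phi> H = H" using fixH H h by (simp add: subgroup.m_inv_closed)
  have nofix: "(?\<phi> ^^ n) C \<noteq> C" if C: "C \<in> ?X" "C \<noteq> H" and n: "0 < n" for C n
  proof
    assume eq: "(?\<phi> ^^ n) C = C"
    obtain g where g: "g \<in> carrier G" "C = g <# H" using C(1) unfolding X by auto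
    hence gH: "g \<notin> H" using fixH C by auto
    let ?k = "h [^] n"
    have k: "?k \<in> carrier G" using hG by simp
    have "inv ?k \<otimes> g \<in> (inv ?k \<otimes> g) <# H" using g k H by (intro lcos_self) auto
    also have "\<dots> = g <# H" using eq funpow[OF C(1)] g k HG by (simp add: lcos_m_assoc)
    finally have "inv g \<otimes> (inv ?k \<otimes> g) \<in> H"
      using subgroup.lcos_module_imp[OF H is_group g(1)] by blast
    hence "inv (inv g \<otimes> (inv ?k \<otimes> g)) \<in> H" using H by (rule subgroup.m_inv_closed[rotated])
    hence "inv g \<otimes> ?k \<otimes> g \<in> H" using g k by (simp add: inv_mult_group m_assoc)
    with free[OF g(1) gH n] show False by blast
  qed
  have "delta H \<in> ell2 ?X" by (rule delta_in_ell2[OF HX])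
  hence ne: "ell2 ?X \<noteq> {\<lambda>_. 0}"
    by (metis delta_def singletonD zero_neq_one)
  have "W = {\<lambda>_. 0} \<or> W = ell2 ?X"
    if W: "ell2_closed_subspace ?X W"
      and inv: "\<And>g \<xi>. g \<in> carrier G \<Longrightarrow> \<xi> \<in> W \<Longrightarrow> quasi_regular G H g \<xi> \<in> W" for W
  proof (cases "W = {\<lambda>_. 0}")
    case False
    have sub: "W \<subseteq> ell2 ?X" and zero: "(\<lambda>_. 0) \<in> W" using W by (auto simp: ell2_closed_subspace_def)
    have add: "(\<lambda>x. \<xi> x + \<eta> x) \<in> W" if "\<xi> \<in> W" "\<eta> \<in> W" for \<xi> \<eta>
      using W that by (simp add: ell2_closed_subspace_def)
    have sc: "(\<lambda>x. a * \<xi> x) \<in> W" if "\<xi> \<in> W" for \<xi> a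
      using W that by (simp add: ell2_closed_subspace_def)
    have lim: "\<xi> \<in> W" if "\<xi> \<in> ell2 ?X" "\<And>n. s n \<in> W"
      "(\<lambda>n. ell2_norm ?X (\<lambda>x. s n x - \<xi> x)) \<longlonglongrightarrow> 0" for s \<xi>
      using W that unfolding ell2_closed_subspace_def by blast
    obtain \<xi>0 where \<xi>0: "\<xi>0 \<in> W" "\<xi>0 \<noteq> (\<lambda>_. 0)" using False zero by blast
    then obtain C where C: "\<xi>0 C \<noteq> 0" unfolding fun_eq_iff by blast
    have "\<xi>0 \<in> ell2 ?X" using \<xi>0(1) sub by auto
    from ell2_zero_outside[OF this, of C] C have "C \<in> ?X" by auto
    then obtain g where g: "g \<in> carrier G" "C = g <# H" unfolding X by auto
    \<comment> \<open>Translation moves a nonzero coefficient to the coset H, where the limit of the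
      averages reads it off.\<close>
    define \<xi> where "\<xi> = quasi_regular G H (inv g) \<xi>0"
    have \<xi>W: "\<xi> \<in> W" unfolding \<xi>_def using inv g \<xi>0 by simp
    have \<xi>H: "\<xi> H \<noteq> 0" using C g HX by (simp add: \<xi>_def quasi_regular_def)
    let ?s = "\<lambda>N C. if C \<in> ?X then (\<Sum>n<Suc N. \<xi> ((?\<phi> ^^ n) C)) / of_nat (Suc N) else 0"
    have sumW: "(\<lambda>C. \<Sum>n<N. quasi_regular G H (h [^] n) \<xi> C) \<in> W" for N :: nat
    proof (induction N)
      case 0
      then show ?case using zero by simp
    next
      case (Suc N)
      from add[OF this inv[OF _ \<xi>W, of "h [^] N"]] hG show ?case by simp
    qed
    have "?s N = (\<lambda>C. (1 / of_nat (Suc N)) * (\<Sum>n<Suc N. quasi_regular G H (h [^] n) \<xi> C))" for N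
      by (rule ext) (simp add: quasi_regular_def funpow del: sum.lessThan_Suc of_nat_Suc)
    hence sW: "?s N \<in> W" for N by (simp only:) (rule sc[OF sumW])
    have "(\<lambda>C. \<xi> H * delta H C) \<in> W"
    proof (rule lim)
      show "(\<lambda>C. \<xi> H * delta H C) \<in> ell2 ?X" by (intro ell2_scale delta_in_ell2 HX)
      show "?s N \<in> W" for N by (rule sW)
      show "(\<lambda>N. ell2_norm ?X (\<lambda>C. ?s N C - \<xi> H * delta H C)) \<longlonglongrightarrow> 0"
        using \<xi>W sub by (intro ergodic_average_tendsto inj into HX fx nofix) auto
    qed
    from sc[OF this, of "1 / \<xi> H"] \<xi>H have dH: "delta H \<in> W" by simp
    have "delta D \<in> W" if D: "D \<in> ?X" for D
    proof -
      obtain k where k: "k \<in> carrier G" "D = k <# H" using D unfolding X by auto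
      have "inv k <# E = H \<longleftrightarrow> E = D" if "E \<in> ?X" for E
        using cancel[OF k(1) that] cancel[OF k(1) HX] k(2) by auto
      hence "quasi_regular G H k (delta H) = delta D"
        using D by (auto simp: quasi_regular_def delta_def fun_eq_iff)
      with inv[OF k(1) dH] show ?thesis by simp
    qed
    with closed_subspace_eq_ell2[OF W] show ?thesis by blast
  qed auto
  with ne show ?thesis
    unfolding quasi_regular_irreducible_def irreducible_on_ell2_def by blast
qed

section \<open>Thompson's group\<close>

definition affine_off :: "real set \<Rightarrow> (real \<Rightarrow> real) \<Rightarrow> bool" where
  "affine_off D f \<longleftrightarrow> (\<forall>a b. 0 \<le> a \<and> a < b \<and> b \<le> 1 \<and> {a<..<b} \<inter> D = {} \<longrightarrow>
     (\<exists>(k::int) c. \<forall>x\<in>{a..b}. f x = 2 powi k * x + c))"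

text \<open>Anchoring the affine piece at its left end eliminates the constant and lets pieces be
  composed and inverted without computing intercepts.\<close>

lemma affine_offE:
  assumes "affine_off D f" "0 \<le> a" "a < b" "b \<le> 1" "{a<..<b} \<inter> D = {}"
  obtains k :: int where "\<And>x. a \<le> x \<Longrightarrow> x \<le> b \<Longrightarrow> f x = f a + 2 powi k * (x - a)"
proof -
  obtain k :: int and c where "\<forall>x\<in>{a..b}. f x = 2 powi k * x + c"
    using assms unfolding affine_off_def by blast
  hence "f x = f a + 2 powi k * (x - a)" if "a \<le> x" "x \<le> b" for x
    using that by (simp add: algebra_simps)
  thus ?thesis using that by blast
qed

lemma affine_offI:
  assumes "\<And>a b. 0 \<le> a \<Longrightarrow> a < b \<Longrightarrow> b \<le> 1 \<Longrightarrow> {a<..<b} \<inter> D = {} \<Longrightarrow>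
    \<exists>k::int. \<forall>x\<in>{a..b}. f x = f a + 2 powi k * (x - a)"
  shows "affine_off D f"
  unfolding affine_off_def
proof (intro allI impI)
  fix a b :: real
  assume "0 \<le> a \<and> a < b \<and> b \<le> 1 \<and> {a<..<b} \<inter> D = {}"
  then obtain k :: int where k: "\<forall>x\<in>{a..b}. f x = f a + 2 powi k * (x - a)"
    using assms by blast
  show "\<exists>(k::int) c. \<forall>x\<in>{a..b}. f x = 2 powi k * x + c"
    by (rule exI[of _ k], rule exI[of _ "f a - 2 powi k * a"]) (use k in \<open>auto simp: algebra_simps\<close>)
qed

lemma thompson_F_iff:
  "f \<in> carrier thompson_F \<longleftrightarrow> f \<in> extensional {0..1} \<and> (\<exists>g. homeomorphism {0..1} {0..1} f g) \<and>
     (\<exists>D. finite D \<and> D \<subseteq> dyadic_rationals \<and> affine_off D f)"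
  by (simp add: thompson_F_def thompson_F_maps_def affine_off_def)

lemma thompson_F_breaks:
  assumes "f \<in> carrier thompson_F"
  obtains D where "finite D" "D \<subseteq> dyadic_rationals" "affine_off D f"
  using assms by (auto simp: thompson_F_iff)

lemma dyadic_add: "x \<in> dyadic_rationals \<Longrightarrow> y \<in> dyadic_rationals \<Longrightarrow> x + y \<in> dyadic_rationals"
proof -
  assume "x \<in> dyadic_rationals" "y \<in> dyadic_rationals"
  then obtain a m b n where "x = of_int a / 2 ^ m" "y = of_int b / 2 ^ n"
    by (auto simp: dyadic_rationals_def)
  hence "x = of_int (a * 2 ^ n) / 2 ^ (m + n)" "y = of_int (b * 2 ^ m) / 2 ^ (m + n)"
    by (simp_all add: power_add)
  hence "x + y = of_int (a * 2 ^ n + b * 2 ^ m) / 2 ^ (m + n)"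
    by (simp add: add_divide_distrib)
  thus ?thesis unfolding dyadic_rationals_def by blast
qed

lemma dyadic_uminus: "x \<in> dyadic_rationals \<Longrightarrow> - x \<in> dyadic_rationals"
proof -
  assume "x \<in> dyadic_rationals"
  then obtain a n where "x = of_int a / 2 ^ n" by (auto simp: dyadic_rationals_def)
  hence "- x = of_int (- a) / 2 ^ n" by simp
  thus ?thesis unfolding dyadic_rationals_def by blast
qed

lemma dyadic_of_int: "of_int a \<in> dyadic_rationals"
  unfolding dyadic_rationals_def by (rule CollectI, rule exI[of _ a], rule exI[of _ 0]) simp

lemma dyadic_power_int: "x \<in> dyadic_rationals \<Longrightarrow> 2 powi k * x \<in> dyadic_rationals"
proof -
  assume "x \<in> dyadic_rationals"
  then obtain a n where x: "x = of_int a / 2 ^ n" by (auto simp: dyadic_rationals_def)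
  show ?thesis
  proof (cases "0 \<le> k")
    case True
    hence "2 powi k * x = of_int (2 ^ nat k * a) / 2 ^ n" using x by (simp add: power_int_def)
    thus ?thesis unfolding dyadic_rationals_def by blast
  next
    case False
    hence "2 powi k * x = of_int a / 2 ^ (n + nat (- k))"
      using x by (simp add: power_int_def field_simps power_add)
    thus ?thesis unfolding dyadic_rationals_def by blast
  qed
qed

text \<open>Each affine piece increases because its slope is a power of 2. Induction on the number
  of breaks inside the interval, split at one of them, joins the pieces.\<close>

lemma thompson_F_strict_mono:
  assumes f: "f \<in> carrier thompson_F" and "0 \<le> a" "a < b" "b \<le> 1"
  shows "f a < f b"
proof -
  obtain D where D: "finite D" "affine_off D f" using thompson_F_breaks[OF f] by metis
  show ?thesis using assms(2-4)
  proof (induction "card (D \<inter> {a<..<b})" arbitrary: a b rule: less_induct)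
    case less
    show ?case
    proof (cases "{a<..<b} \<inter> D = {}")
      case True
      then obtain k :: int where "\<And>x. a \<le> x \<Longrightarrow> x \<le> b \<Longrightarrow> f x = f a + 2 powi k * (x - a)"
        using affine_offE[OF D(2)] less.prems by metis
      from this[of b] less.prems show ?thesis by simp
    next
      case False
      then obtain d where d: "d \<in> D" "a < d" "d < b" by auto
      have "D \<inter> {a<..<d} \<subset> D \<inter> {a<..<b}" "D \<inter> {d<..<b} \<subset> D \<inter> {a<..<b}"
        using d by auto
      hence "card (D \<inter> {a<..<d}) < card (D \<inter> {a<..<b})" "card (D \<inter> {d<..<b}) < card (D \<inter> {a<..<b})"
        using D(1) by (auto intro!: psubset_card_mono)
      from less.hyps[OF this(1)] less.hyps[OF this(2)] d less.prems show ?thesis by force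
    qed
  qed
qed

lemma thompson_F_less_iff:
  assumes "f \<in> carrier thompson_F" "x \<in> {0..1}" "y \<in> {0..1}"
  shows "f x < f y \<longleftrightarrow> x < y"
  using thompson_F_strict_mono[OF assms(1), of x y] thompson_F_strict_mono[OF assms(1), of y x] assms
  by (cases x y rule: linorder_cases) auto

lemma thompson_F_inj_on:
  assumes "f \<in> carrier thompson_F" shows "inj_on f {0..1}"
  by (rule inj_onI) (metis assms less_irrefl linorder_neqE thompson_F_less_iff)

lemma thompson_F_image: "f \<in> carrier thompson_F \<Longrightarrow> f ` {0..1} = {0..1}"
  by (auto simp: thompson_F_iff homeomorphism_def)

lemma thompson_F_continuous: "f \<in> carrier thompson_F \<Longrightarrow> continuous_on {0..1} f"
  by (auto simp: thompson_F_iff homeomorphism_def)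

lemma thompson_F_range: "f \<in> carrier thompson_F \<Longrightarrow> x \<in> {0..1} \<Longrightarrow> f x \<in> {0..1}"
  using thompson_F_image by blast

lemma thompson_F_0:
  assumes f: "f \<in> carrier thompson_F" shows "f 0 = 0"
proof -
  have "(0::real) \<in> f ` {0..1}" unfolding thompson_F_image[OF f] by simp
  then obtain x where x: "x \<in> {0..1}" "f x = 0" by auto
  have "f 0 \<ge> 0" using thompson_F_range[OF f, of 0] by simp
  hence "\<not> 0 < x" using thompson_F_strict_mono[OF f, of 0 x] x by auto
  with x show ?thesis by auto
qed

lemma thompson_F_1:
  assumes f: "f \<in> carrier thompson_F" shows "f 1 = 1"
proof -
  have "(1::real) \<in> f ` {0..1}" unfolding thompson_F_image[OF f] by simp
  then obtain x where x: "x \<in> {0..1}" "f x = 1" by auto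
  have "f 1 \<le> 1" using thompson_F_range[OF f, of 1] by simp
  hence "\<not> x < 1" using thompson_F_strict_mono[OF f, of x 1] x by auto
  with x show ?thesis by auto
qed

lemma thompson_F_range_less: "f \<in> carrier thompson_F \<Longrightarrow> x \<in> {0..<1} \<Longrightarrow> f x \<in> {0..<1}"
  using thompson_F_range[of f x] thompson_F_strict_mono[of f x 1] thompson_F_1[of f] by auto

text \<open>An affine piece whose slope is a power of 2 and which starts at a dyadic point with
  dyadic value respects dyadic points in both directions, as the inverse slope is again a power of
  2. The induction runs through the breaks from 0 up to x.\<close>

lemma thompson_F_dyadic_iff:
  assumes f: "f \<in> carrier thompson_F" and "0 \<le> x" "x \<le> 1"
  shows "f x \<in> dyadic_rationals \<longleftrightarrow> x \<in> dyadic_rationals"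
proof -
  obtain D where D: "finite D" "D \<subseteq> dyadic_rationals" "affine_off D f"
    using thompson_F_breaks[OF f] by blast
  have z: "(0::real) \<in> dyadic_rationals" using dyadic_of_int[of 0] by simp
  have step: "f x \<in> dyadic_rationals \<longleftrightarrow> x \<in> dyadic_rationals"
    if d: "d \<in> dyadic_rationals" "f d \<in> dyadic_rationals" "0 \<le> d" "d < x" "x \<le> 1"
      "{d<..<x} \<inter> D = {}" for d x
  proof -
    obtain k :: int where "\<And>y. d \<le> y \<Longrightarrow> y \<le> x \<Longrightarrow> f y = f d + 2 powi k * (y - d)"
      using affine_offE[OF D(3) d(3-6)] by blast
    from this[of x] d have fx: "f x = f d + 2 powi k * (x - d)" by simp
    have "2 powi (- k) * 2 powi k = (1::real)" by (simp add: power_int_minus)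
    hence "2 powi (- k) * (2 powi k * (x - d)) = x - d"
      by (metis mult.assoc mult_1)
    hence "2 powi (- k) * (f x - f d) = x - d" unfolding fx add_diff_cancel_left' .
    hence "x = d + 2 powi (- k) * (f x - f d)" by linarith
    moreover have "f x - f d \<in> dyadic_rationals" if "f x \<in> dyadic_rationals"
      using dyadic_add[OF that dyadic_uminus[OF d(2)]] by simp
    moreover have "x - d \<in> dyadic_rationals" if "x \<in> dyadic_rationals"
      using dyadic_add[OF that dyadic_uminus[OF d(1)]] by simp
    ultimately show ?thesis
      using fx dyadic_add d(1,2) dyadic_power_int by metis
  qed
  show ?thesis using assms(2,3)
  proof (induction "card (D \<inter> {0<..<x})" arbitrary: x rule: less_induct)
    case less
    consider "x = 0" | "0 < x" "{0<..<x} \<inter> D = {}" | "0 < x" "{0<..<x} \<inter> D \<noteq> {}"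
      using less.prems by fastforce
    thus ?case
    proof cases
      case 1
      thus ?thesis using thompson_F_0[OF f] by simp
    next
      case 2
      thus ?thesis using step[of 0 x] thompson_F_0[OF f] z less.prems by simp
    next
      case 3
      \<comment> \<open>The last break before x: the piece from it to x is affine, and fewer breaks
        lie below it.\<close>
      let ?d = "Max ({0<..<x} \<inter> D)"
      have fin: "finite ({0<..<x} \<inter> D)" using D by simp
      have d: "?d \<in> {0<..<x} \<inter> D" using Max_in[OF fin 3(2)] .
      have gap: "{?d<..<x} \<inter> D = {}"
      proof (rule ccontr)
        assume "{?d<..<x} \<inter> D \<noteq> {}"
        then obtain y where y: "?d < y" "y < x" "y \<in> D" by (metis IntE equals0I greaterThanLessThan_iff)
        have "y \<in> {0<..<x} \<inter> D" using y d by (meson IntD1 IntI greaterThanLessThan_iff less_trans)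
        from Max_ge[OF fin this] y(1) show False by simp
      qed
      have "D \<inter> {0<..<?d} \<subset> D \<inter> {0<..<x}" using d by auto
      hence "card (D \<inter> {0<..<?d}) < card (D \<inter> {0<..<x})"
        using D(1) by (auto intro!: psubset_card_mono)
      from less.hyps[OF this] d less.prems D(2)
      have "?d \<in> dyadic_rationals" "f ?d \<in> dyadic_rationals" by auto
      from step[OF this _ _ _ gap] d less.prems show ?thesis by auto
    qed
  qed
qed

section \<open>The group structure\<close>

lemma thompson_F_mult: "f \<otimes>\<^bsub>thompson_F\<^esub> g = compose {0..1} g f"
  by (simp add: thompson_F_def)

lemma thompson_F_mult_apply: "x \<in> {0..1} \<Longrightarrow> (f \<otimes>\<^bsub>thompson_F\<^esub> g) x = g (f x)"
  by (simp add: thompson_F_mult compose_eq)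

lemma thompson_F_one: "\<one>\<^bsub>thompson_F\<^esub> = (\<lambda>x\<in>{0..1}. x)"
  by (simp add: thompson_F_def)

lemma thompson_F_m_closed:
  assumes f: "f \<in> carrier thompson_F" and g: "g \<in> carrier thompson_F"
  shows "f \<otimes>\<^bsub>thompson_F\<^esub> g \<in> carrier thompson_F"
proof -
  obtain D where D: "finite D" "D \<subseteq> dyadic_rationals" "affine_off D f"
    using thompson_F_breaks[OF f] by blast
  obtain E where E: "finite E" "E \<subseteq> dyadic_rationals" "affine_off E g"
    using thompson_F_breaks[OF g] by blast
  let ?h = "compose {0..1} g f"
  \<comment> \<open>The composite can break only at a break of f or at a point that f sends to a
    break of g. The latter are finitely many by injectivity and dyadic by
    \<open>thompson_F_dyadic_iff\<close>.\<close>
  let ?D = "D \<union> {x \<in> {0..1}. f x \<in> E}"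
  have "finite {x \<in> {0..1}. f x \<in> E}"
    using finite_vimage_IntI[OF E(1) thompson_F_inj_on[OF f]]
    by (rule finite_subset[rotated]) auto
  hence "finite ?D" using D by simp
  moreover have "?D \<subseteq> dyadic_rationals" using D E thompson_F_dyadic_iff[OF f] by auto
  moreover have "affine_off ?D ?h"
  proof (rule affine_offI)
    fix a b :: real assume ab: "0 \<le> a" "a < b" "b \<le> 1" "{a<..<b} \<inter> ?D = {}"
    obtain j :: int where j: "\<And>x. a \<le> x \<Longrightarrow> x \<le> b \<Longrightarrow> f x = f a + 2 powi j * (x - a)"
      using affine_offE[OF D(3), of a b] ab by blast
    have fab: "0 \<le> f a" "f a < f b" "f b \<le> 1"
      using thompson_F_range[OF f, of a] thompson_F_range[OF f, of b]
        thompson_F_strict_mono[OF f ab(1-3)] ab by auto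
    have "{f a<..<f b} \<inter> E = {}"
    proof (rule ccontr)
      assume "{f a<..<f b} \<inter> E \<noteq> {}"
      then obtain y where y: "f a < y" "y < f b" "y \<in> E" by auto
      have "y \<in> f ` {0..1}" unfolding thompson_F_image[OF f] using y fab by auto
      then obtain x where x: "x \<in> {0..1}" "y = f x" by auto
      hence "a < x" "x < b" using y ab thompson_F_less_iff[OF f] by auto
      with ab(4) x y show False by auto
    qed
    then obtain k :: int where k: "\<And>y. f a \<le> y \<Longrightarrow> y \<le> f b \<Longrightarrow> g y = g (f a) + 2 powi k * (y - f a)"
      using affine_offE[OF E(3) fab] by blast
    have "?h x = ?h a + 2 powi (j + k) * (x - a)" if x: "x \<in> {a..b}" for x
    proof -
      have "f a \<le> f x" "f x \<le> f b"
        using x ab thompson_F_less_iff[OF f, of x a] thompson_F_less_iff[OF f, of b x] by auto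
      with k[of "f x"] j[of x] x ab show ?thesis
        by (simp add: compose_def power_int_add)
    qed
    thus "\<exists>k::int. \<forall>x\<in>{a..b}. ?h x = ?h a + 2 powi k * (x - a)" by blast
  qed
  moreover have "\<exists>k. homeomorphism {0..1} {0..1} ?h k"
  proof -
    obtain f' g' where "homeomorphism {0..1} {0..1} f f'" "homeomorphism {0..1} {0..1} g g'"
      using f g by (auto simp: thompson_F_iff)
    hence "homeomorphism {0..1} {0..1} (g \<circ> f) (f' \<circ> g')" by (rule homeomorphism_compose)
    hence "homeomorphism {0..1} {0..1} ?h (f' \<circ> g')"
      by (rule homeomorphism_cong) (auto simp: compose_def)
    thus ?thesis by blast
  qed
  ultimately show ?thesis unfolding thompson_F_iff thompson_F_mult using compose_extensional by blast
qed

lemma thompson_F_one_closed: "\<one>\<^bsub>thompson_F\<^esub> \<in> carrier thompson_F"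
proof -
  have "affine_off {} (\<lambda>x\<in>{0..1}. x)"
    by (rule affine_offI, rule exI[of _ 0]) auto
  moreover have "homeomorphism {0..1} {0..1} (\<lambda>x\<in>{0..1}. x) (\<lambda>x::real. x)"
    by (rule homeomorphism_cong[OF homeomorphism_ident]) auto
  ultimately show ?thesis unfolding thompson_F_iff thompson_F_one by blast
qed

lemma thompson_F_l_inv_ex:
  assumes f: "f \<in> carrier thompson_F"
  shows "\<exists>g\<in>carrier thompson_F. g \<otimes>\<^bsub>thompson_F\<^esub> f = \<one>\<^bsub>thompson_F\<^esub>"
proof -
  obtain D where D: "finite D" "D \<subseteq> dyadic_rationals" "affine_off D f"
    using thompson_F_breaks[OF f] by blast
  obtain g0 where g0: "homeomorphism {0..1} {0..1} f g0" using f by (auto simp: thompson_F_iff)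
  let ?g = "restrict g0 {0..1}"
  have g: "f (?g y) = y" "?g y \<in> {0..1}" if "y \<in> {0..1}" for y
    using g0 that by (auto simp: homeomorphism_def)
  have gf: "?g (f x) = x" if "x \<in> {0..1}" for x
    using g0 that thompson_F_range[OF f that] by (auto simp: homeomorphism_def)
  \<comment> \<open>The set D may contain points outside the unit interval, where f carries no
    information, so these are dropped before taking images.\<close>
  let ?D = "f ` (D \<inter> {0..1})"
  have "finite ?D" using D by simp
  moreover have "?D \<subseteq> dyadic_rationals" using D thompson_F_dyadic_iff[OF f] by auto
  moreover have "affine_off ?D ?g"
  proof (rule affine_offI)
    fix a b :: real assume ab: "0 \<le> a" "a < b" "b \<le> 1" "{a<..<b} \<inter> ?D = {}"
    have gab: "0 \<le> ?g a" "?g a < ?g b" "?g b \<le> 1"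
      using g[of a] g[of b] ab thompson_F_less_iff[OF f, of "?g a" "?g b"] by auto
    have "{?g a<..<?g b} \<inter> D = {}"
    proof (rule ccontr)
      assume "{?g a<..<?g b} \<inter> D \<noteq> {}"
      then obtain d where d: "?g a < d" "d < ?g b" "d \<in> D" unfolding ex_in_conv[symmetric] by auto
      hence d01: "d \<in> {0..1}" using gab by auto
      hence "f (?g a) < f d" "f d < f (?g b)"
        using d gab thompson_F_less_iff[OF f] by auto
      hence "a < f d" "f d < b" using g ab by auto
      with ab(4) d d01 show False by auto
    qed
    then obtain k :: int where k: "\<And>x. ?g a \<le> x \<Longrightarrow> x \<le> ?g b \<Longrightarrow> f x = f (?g a) + 2 powi k * (x - ?g a)"
      using affine_offE[OF D(3) gab] by blast
    have "?g y = ?g a + 2 powi (- k) * (y - a)" if y: "y \<in> {a..b}" for y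
    proof -
      have y01: "y \<in> {0..1}" "a \<in> {0..1}" "b \<in> {0..1}" using y ab by auto
      have "?g a \<le> ?g y" "?g y \<le> ?g b"
        using y g y01 thompson_F_less_iff[OF f, of "?g y" "?g a"]
          thompson_F_less_iff[OF f, of "?g b" "?g y"] by (auto simp: not_less)
      from k[OF this] have "y = a + 2 powi k * (?g y - ?g a)" using g y01 by simp
      thus ?thesis by (simp add: power_int_minus field_simps)
    qed
    thus "\<exists>k::int. \<forall>x\<in>{a..b}. ?g x = ?g a + 2 powi k * (x - a)" by blast
  qed
  moreover have "homeomorphism {0..1} {0..1} ?g f"
    by (rule homeomorphism_cong[OF homeomorphism_symD[OF g0]]) auto
  ultimately have "?g \<in> carrier thompson_F" unfolding thompson_F_iff by blast
  moreover have "?g \<otimes>\<^bsub>thompson_F\<^esub> f = \<one>\<^bsub>thompson_F\<^esub>"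
    using g by (auto simp: thompson_F_mult thompson_F_one compose_def restrict_def fun_eq_iff)
  ultimately show ?thesis by blast
qed

lemma group_thompson_F: "group thompson_F"
proof (rule groupI)
  fix f g h assume *: "f \<in> carrier thompson_F" "g \<in> carrier thompson_F" "h \<in> carrier thompson_F"
  show "f \<otimes>\<^bsub>thompson_F\<^esub> g \<otimes>\<^bsub>thompson_F\<^esub> h = f \<otimes>\<^bsub>thompson_F\<^esub> (g \<otimes>\<^bsub>thompson_F\<^esub> h)"
    using thompson_F_range[OF *(1)] by (auto simp: thompson_F_mult compose_def fun_eq_iff)
next
  fix f assume f: "f \<in> carrier thompson_F"
  hence "f \<in> extensional {0..1}" by (simp add: thompson_F_iff)
  thus "\<one>\<^bsub>thompson_F\<^esub> \<otimes>\<^bsub>thompson_F\<^esub> f = f"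
    by (auto simp: thompson_F_mult thompson_F_one compose_def fun_eq_iff extensional_def)
qed (auto simp: thompson_F_m_closed thompson_F_one_closed thompson_F_l_inv_ex)

subsection \<open>The parity cocycle\<close>

text \<open>Only slopes to the right are used, so breakpoints need no separate treatment.\<close>

definition has_rslope :: "(real \<Rightarrow> real) \<Rightarrow> real \<Rightarrow> int \<Rightarrow> bool" where
  "has_rslope f x k \<longleftrightarrow> (\<exists>e>0. x + e \<le> 1 \<and> (\<forall>y\<in>{x..x+e}. f y = f x + 2 powi k * (y - x)))"

lemma has_rslopeI:
  assumes "x < b" "b \<le> 1" "\<And>y. x \<le> y \<Longrightarrow> y \<le> b \<Longrightarrow> f y = f x + 2 powi k * (y - x)"
  shows "has_rslope f x k"
  unfolding has_rslope_def
proof (intro exI[of _ "b - x"] conjI ballI)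
  fix y assume "y \<in> {x..x + (b - x)}"
  hence "x \<le> y" "y \<le> b" by auto
  thus "f y = f x + 2 powi k * (y - x)" by (rule assms(3))
qed (use assms(1,2) in auto)

lemma has_rslope_ex:
  assumes f: "f \<in> carrier thompson_F" and x: "x \<in> {0..<1}"
  shows "\<exists>k. has_rslope f x k"
proof -
  obtain D where D: "finite D" "affine_off D f" using thompson_F_breaks[OF f] by metis
  \<comment> \<open>The next break to the right of x, or 1 if none comes earlier.\<close>
  define b where "b = Min (insert 1 {d \<in> D. x < d})"
  have fin: "finite (insert 1 {d \<in> D. x < d})" using D by simp
  have b: "x < b" "b \<le> 1" using fin x by (auto simp: b_def)
  have gap: "{x<..<b} \<inter> D = {}" unfolding b_def using Min_le[OF fin] by (force simp: disjoint_iff)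
  have x0: "0 \<le> x" using x by simp
  obtain k :: int where "\<And>y. x \<le> y \<Longrightarrow> y \<le> b \<Longrightarrow> f y = f x + 2 powi k * (y - x)"
    using affine_offE[OF D(2) x0 b gap] by metis
  with b have "has_rslope f x k" by (rule has_rslopeI)
  thus ?thesis ..
qed

lemma has_rslope_unique:
  assumes "has_rslope f x j" "has_rslope f x k" shows "j = k"
proof -
  obtain d where d: "0 < d" "\<forall>y\<in>{x..x+d}. f y = f x + 2 powi j * (y - x)"
    using assms(1) unfolding has_rslope_def by blast
  obtain e where e: "0 < e" "\<forall>y\<in>{x..x+e}. f y = f x + 2 powi k * (y - x)"
    using assms(2) unfolding has_rslope_def by blast
  let ?y = "x + min d e"
  have "?y \<in> {x..x+d}" "?y \<in> {x..x+e}" "?y - x > 0" using d(1) e(1) by auto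
  hence eq: "f x + 2 powi j * (?y - x) = f x + 2 powi k * (?y - x)" and nz: "?y - x \<noteq> 0"
    using d(2) e(2) by (metis, linarith)
  from eq have "2 powi j = (2 powi k :: real)" unfolding add_left_cancel mult_right_cancel[OF nz] .
  thus ?thesis
    using power_int_strict_increasing[of j k "2::real"] power_int_strict_increasing[of k j "2::real"]
    by (cases j k rule: linorder_cases) auto
qed

lemma has_rslope_mult:
  assumes f: "f \<in> carrier thompson_F" and x: "x \<in> {0..<1}"
    and j: "has_rslope f x j" and k: "has_rslope g (f x) k"
  shows "has_rslope (f \<otimes>\<^bsub>thompson_F\<^esub> g) x (j + k)"
proof -
  obtain d where d: "0 < d" "x + d \<le> 1" "\<forall>y\<in>{x..x+d}. f y = f x + 2 powi j * (y - x)"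
    using j unfolding has_rslope_def by blast
  obtain e where e: "0 < e" "\<forall>y\<in>{f x..f x+e}. g y = g (f x) + 2 powi k * (y - f x)"
    using k unfolding has_rslope_def by blast
  \<comment> \<open>The second bound keeps f y within the interval on which g is known to be
    affine.\<close>
  let ?e = "min d (e / 2 powi j)"
  show ?thesis unfolding has_rslope_def
  proof (intro exI[of _ ?e] conjI ballI)
    fix y assume y: "y \<in> {x..x + ?e}"
    hence "y \<in> {x..x + d}" by auto
    with d(3) have fy: "f y = f x + 2 powi j * (y - x)" by blast
    have "y - x \<le> e / 2 powi j" using y by auto
    hence "2 powi j * (y - x) \<le> e" by (simp add: field_simps)
    hence "f y \<in> {f x..f x + e}" unfolding fy using y by auto
    with e have "g (f y) = g (f x) + 2 powi k * (f y - f x)" by blast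
    moreover have "y \<in> {0..1}" "x \<in> {0..1}" using x y d(1,2) by auto
    ultimately show "(f \<otimes>\<^bsub>thompson_F\<^esub> g) y = (f \<otimes>\<^bsub>thompson_F\<^esub> g) x + 2 powi (j + k) * (y - x)"
      using fy by (simp add: thompson_F_mult_apply power_int_add)
  qed (use d(1,2) e(1) in auto)
qed

text \<open>Writing \<open>s x = 1\<close> for \<open>x < 1/2\<close> and \<open>s x = -1\<close> otherwise, \<open>even_at f x\<close> says that the slope
  exponent \<open>k\<close> of \<open>f\<close> at \<open>x\<close> satisfies \<open>(-1)\<^sup>k = s x * s (f x)\<close>.\<close>

definition even_at :: "(real \<Rightarrow> real) \<Rightarrow> real \<Rightarrow> bool" where
  "even_at f x \<longleftrightarrow> (\<exists>k. has_rslope f x k \<and> (even k \<longleftrightarrow> (x < 1/2 \<longleftrightarrow> f x < 1/2)))"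

lemma even_at_iff: "has_rslope f x k \<Longrightarrow> even_at f x \<longleftrightarrow> (even k \<longleftrightarrow> (x < 1/2 \<longleftrightarrow> f x < 1/2))"
  unfolding even_at_def using has_rslope_unique by blast

text \<open>Slope exponents add, and the side of the intermediate point f x enters both factors and
  cancels. With truth values read as signs this is the cocycle identity.\<close>

lemma even_at_mult:
  assumes f: "f \<in> carrier thompson_F" and g: "g \<in> carrier thompson_F" and x: "x \<in> {0..<1}"
  shows "even_at (f \<otimes>\<^bsub>thompson_F\<^esub> g) x \<longleftrightarrow> (even_at f x \<longleftrightarrow> even_at g (f x))"
proof -
  obtain j where j: "has_rslope f x j" using has_rslope_ex[OF f x] by blast
  obtain k where k: "has_rslope g (f x) k"
    using has_rslope_ex[OF g thompson_F_range_less[OF f x]] by blast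
  have "x \<in> {0..1}" using x by auto
  thus ?thesis
    using even_at_iff[OF has_rslope_mult[OF f x j k]] even_at_iff[OF j] even_at_iff[OF k]
    by (auto simp: thompson_F_mult_apply)
qed

lemma even_at_one: "x \<in> {0..<1} \<Longrightarrow> even_at \<one>\<^bsub>thompson_F\<^esub> x"
  by (subst even_at_iff[where k = 0])
    (auto simp: has_rslope_def thompson_F_one intro!: exI[of _ "1 - x"])

text \<open>The kernel of the cocycle. The point 1 is left out because it has no slope to the
  right.\<close>

definition even_F :: "(real \<Rightarrow> real) set" where
  "even_F = {f \<in> carrier thompson_F. \<forall>x\<in>{0..<1}. even_at f x}"

lemma subgroup_even_F: "subgroup even_F thompson_F"
proof -
  interpret group thompson_F by (rule group_thompson_F)
  show ?thesis
  proof (rule subgroupI)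
    show "even_F \<subseteq> carrier thompson_F" by (auto simp: even_F_def)
    show "even_F \<noteq> {}" using even_at_one by (auto simp: even_F_def)
    fix f assume f: "f \<in> even_F"
    hence fc: "f \<in> carrier thompson_F" by (simp add: even_F_def)
    let ?g = "inv\<^bsub>thompson_F\<^esub> f"
    have g: "?g \<in> carrier thompson_F" using fc by simp
    have "even_at ?g x" if x: "x \<in> {0..<1}" for x
      using even_at_mult[OF g fc x] even_at_one[OF x] f thompson_F_range_less[OF g x]
      by (simp add: even_F_def l_inv[OF fc])
    with g show "?g \<in> even_F" by (simp add: even_F_def)
    fix g assume "g \<in> even_F"
    with f show "f \<otimes>\<^bsub>thompson_F\<^esub> g \<in> even_F"
      using even_at_mult thompson_F_range_less by (auto simp: even_F_def)
  qed
qed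

section \<open>Tree diagrams and colorings\<close>

text \<open>The left end of the standard dyadic interval of the word, whose length is
  \<open>1 / 2 ^ length w\<close>.\<close>

primrec wval :: "bool list \<Rightarrow> real" where
  "wval [] = 0"
| "wval (b # w) = (of_bool b + wval w) / 2"

lemma wval_nonneg: "0 \<le> wval w"
  by (induction w) auto

lemma wval_end_le: "wval w + 1 / 2 ^ length w \<le> 1"
proof (induction w)
  case (Cons b w)
  have "wval (b # w) + 1 / 2 ^ length (b # w) = (of_bool b + (wval w + 1 / 2 ^ length w)) / 2"
    by simp
  also have "\<dots> \<le> 1" using Cons by (cases b) auto
  finally show ?case .
qed simp

lemma wval_lt_1: "wval w < 1"
proof -
  have "0 < 1 / (2::real) ^ length w" by simp
  with wval_end_le[of w] show ?thesis by linarith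
qed

lemma wval_append: "wval (v @ w) = wval v + wval w / 2 ^ length v"
  by (induction v) (auto simp: field_simps)

lemma wval_numerator: "\<exists>m::int. wval w = of_int m / 2 ^ length w"
proof (induction w)
  case (Cons b w)
  then obtain m :: int where m: "wval w = of_int m / 2 ^ length w" by blast
  have "wval (b # w) = of_int (of_bool b * 2 ^ length w + m) / 2 ^ length (b # w)"
    using m by (cases b) (simp_all add: field_simps)
  thus ?case by blast
qed (auto intro: exI[of _ 0])

lemma wval_surj:
  fixes m :: int
  assumes "0 \<le> m" "m < 2 ^ p"
  shows "\<exists>w. length w = p \<and> wval w = of_int m / 2 ^ p"
  using assms
proof (induction p arbitrary: m)
  case (Suc p)
  show ?case
  proof (cases "m < 2 ^ p")
    case True
    then obtain w where "length w = p" "wval w = of_int m / 2 ^ p" using Suc by blast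
    thus ?thesis by (intro exI[of _ "False # w"]) simp
  next
    case False
    then obtain w where "length w = p" "wval w = of_int (m - 2 ^ p) / 2 ^ p"
      using Suc.IH[of "m - 2 ^ p"] Suc.prems by auto
    thus ?thesis by (intro exI[of _ "True # w"]) (simp add: field_simps)
  qed
qed auto

lemma summable_binary: "summable (\<lambda>i. of_bool (\<gamma> !! i) / 2 ^ Suc i :: real)"
proof (rule summable_comparison_test')
  show "summable (\<lambda>i. (1/2) ^ Suc i :: real)" using power_half_series by (rule sums_summable)
  show "norm (of_bool (\<gamma> !! i) / 2 ^ Suc i :: real) \<le> (1/2) ^ Suc i" for i
    by (cases "\<gamma> !! i") (auto simp: power_one_over)
qed

lemma binary_value_bounds: "0 \<le> binary_value \<gamma>" "binary_value \<gamma> \<le> 1"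
proof -
  show "0 \<le> binary_value \<gamma>"
    unfolding binary_value_def by (rule suminf_nonneg[OF summable_binary]) simp
  have "binary_value \<gamma> \<le> (\<Sum>i. (1/2) ^ Suc i)"
    unfolding binary_value_def
  proof (rule suminf_le[OF _ summable_binary])
    show "summable (\<lambda>i. (1/2) ^ Suc i :: real)" using power_half_series by (rule sums_summable)
    show "(of_bool (\<gamma> !! i) / 2 ^ Suc i :: real) \<le> (1/2) ^ Suc i" for i
      by (cases "\<gamma> !! i") (auto simp: power_one_over)
  qed
  also have "\<dots> = 1" using power_half_series by (rule sums_unique[symmetric])
  finally show "binary_value \<gamma> \<le> 1" .
qed

lemma binary_value_SCons: "binary_value (b ## \<gamma>) = (of_bool b + binary_value \<gamma>) / 2"
proof -
  have "(\<Sum>i. of_bool (\<gamma> !! i) / 2 ^ Suc i / 2 :: real) = binary_value \<gamma> / 2"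
    unfolding binary_value_def by (rule suminf_divide[OF summable_binary])
  moreover have "(\<Sum>i. of_bool ((b ## \<gamma>) !! Suc i) / 2 ^ Suc (Suc i) :: real) =
      binary_value (b ## \<gamma>) - of_bool ((b ## \<gamma>) !! 0) / 2 ^ Suc 0"
    unfolding binary_value_def by (rule suminf_split_head[OF summable_binary])
  ultimately show ?thesis by (simp add: field_simps)
qed

lemma binary_value_shift: "binary_value (w @- \<gamma>) = wval w + binary_value \<gamma> / 2 ^ length w"
  by (induction w) (auto simp: binary_value_SCons field_simps)

text \<open>The digits are read off along the orbit of y under the doubling map, and the error after
  n digits is the n-th iterate divided by 2^n. Since \<open>step\<close> fixes 1, the point 1 gets
  the expansion with all digits 1.\<close>

lemma binary_value_surj:
  assumes "0 \<le> y" "y \<le> 1"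
  obtains \<gamma> where "binary_value \<gamma> = y"
proof -
  define step :: "real \<Rightarrow> real" where "step y = (if y \<ge> 1/2 then 2 * y - 1 else 2 * y)" for y
  define \<gamma> where "\<gamma> = smap (\<lambda>y. y \<ge> 1/2) (siterate step y)"
  have nth: "\<gamma> !! i \<longleftrightarrow> (step ^^ i) y \<ge> 1/2" for i by (simp add: \<gamma>_def snth_siterate)
  have range: "0 \<le> (step ^^ i) y \<and> (step ^^ i) y \<le> 1" for i
    by (induction i) (use assms in \<open>auto simp: step_def\<close>)
  have partial: "(\<Sum>i<n. of_bool (\<gamma> !! i) / 2 ^ Suc i) = y - (step ^^ n) y / 2 ^ n" for n
  proof (induction n)
    case (Suc n)
    have "step z / 2 ^ Suc n = z / 2 ^ n - of_bool (z \<ge> 1/2) / 2 ^ Suc n" for z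
      by (simp add: step_def diff_divide_distrib)
    from this[of "(step ^^ n) y"] show ?case using Suc unfolding nth sum.lessThan_Suc
      by (simp only: funpow.simps comp_apply)
  qed simp
  have "(\<lambda>n. y - (step ^^ n) y / 2 ^ n) \<longlonglongrightarrow> y - 0"
  proof (intro tendsto_diff tendsto_const)
    have "(\<lambda>n. (1/2) ^ n :: real) \<longlonglongrightarrow> 0" by (rule LIMSEQ_realpow_zero) auto
    thus "(\<lambda>n. (step ^^ n) y / 2 ^ n) \<longlonglongrightarrow> 0"
    proof (rule Lim_null_comparison[rotated])
      show "\<forall>\<^sub>F n in sequentially. norm ((step ^^ n) y / 2 ^ n) \<le> (1/2) ^ n"
        using range by (auto simp: power_one_over divide_right_mono intro!: always_eventually)
    qed
  qed
  hence "(\<lambda>i. of_bool (\<gamma> !! i) / 2 ^ Suc i) sums y" unfolding sums_def partial by simp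
  hence "binary_value \<gamma> = y" unfolding binary_value_def by (rule sums_unique[symmetric])
  thus ?thesis by (rule that)
qed

text \<open>Binary values fill the closed unit interval, so infinite words can be exchanged for a
  real parameter on each leaf interval.\<close>

lemma tree_diagram_of_iff:
  "tree_diagram_of Tp Tm f \<longleftrightarrow> length (leaves Tp) = length (leaves Tm) \<and>
     (\<forall>k < length (leaves Tp). \<forall>y\<in>{0..1}.
        f (wval (leaves Tp ! k) + y / 2 ^ length (leaves Tp ! k)) =
        wval (leaves Tm ! k) + y / 2 ^ length (leaves Tm ! k))"
proof -
  have "(\<forall>\<gamma>. P (binary_value \<gamma>)) \<longleftrightarrow> (\<forall>y\<in>{0..1}. P y)" for P
    using binary_value_bounds binary_value_surj by (metis atLeastAtMost_iff)
  from this[of "\<lambda>y. f (wval v + y / 2 ^ length v) = wval w + y / 2 ^ length w" for v w]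
  show ?thesis unfolding tree_diagram_of_def binary_value_shift by simp
qed

lemma leaves_cover:
  assumes "x \<in> {0..<1}"
  shows "\<exists>w\<in>set (leaves T). \<exists>y\<in>{0..<1}. x = wval w + y / 2 ^ length w"
  using assms
proof (induction T arbitrary: x)
  case Leaf
  then show ?case by auto
next
  case (Caret l r)
  show ?case
  proof (cases "x < 1/2")
    case True
    hence "2 * x \<in> {0..<1}" using Caret.prems by auto
    from Caret.IH(1)[OF this] obtain w y where
      "w \<in> set (leaves l)" "y \<in> {0..<1}" "2 * x = wval w + y / 2 ^ length w" by blast
    thus ?thesis by (intro bexI[of _ "False # w"] bexI[of _ y]) (auto simp: field_simps)
  next
    case False
    hence "2 * x - 1 \<in> {0..<1}" using Caret.prems by auto
    from Caret.IH(2)[OF this] obtain w y where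
      "w \<in> set (leaves r)" "y \<in> {0..<1}" "2 * x - 1 = wval w + y / 2 ^ length w" by blast
    thus ?thesis by (intro bexI[of _ "True # w"] bexI[of _ y]) (auto simp: field_simps)
  qed
qed

text \<open>This translates the side of 1/2, which occurs in \<open>even_at\<close>, into the first
  digit of a leaf. Half-open intervals keep 1/2 itself on the right.\<close>

lemma wval_less_half_iff:
  assumes "w \<noteq> []" "y \<in> {0..<1}"
  shows "wval w + y / 2 ^ length w < 1/2 \<longleftrightarrow> \<not> hd w"
proof -
  obtain b u where w: "w = b # u" using assms(1) by (cases w) auto
  define t where "t = wval u + y / 2 ^ length u"
  have eq: "wval w + y / 2 ^ length w = (of_bool b + t) / 2"
    by (simp add: w t_def)
  have "0 \<le> t" using wval_nonneg[of u] assms by (simp add: t_def)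
  moreover have "y / 2 ^ length u < 1 / 2 ^ length u"
    using assms by (intro divide_strict_right_mono) auto
  hence "t < 1" using wval_end_le[of u] unfolding t_def by linarith
  ultimately show ?thesis unfolding eq by (cases b) (auto simp: w)
qed

lemma leaves_not_Nil: "leaves T \<noteq> []"
  by (induction T) auto

lemma Nil_notin_leaves_Caret: "[] \<notin> set (leaves (Caret l r))"
  by auto

text \<open>The slope exponent is the difference of the two depths and the sides are the two first
  digits. Hence the condition separates into one sign for each of the two opposed leaves, to be
  compared with each other.\<close>

lemma tree_diagram_even_at_iff:
  assumes d: "tree_diagram_of Tp Tm f" and k: "k < length (leaves Tp)"
    and v: "v = leaves Tp ! k" and w: "w = leaves Tm ! k" and y: "y \<in> {0..<1}"
  shows "has_rslope f (wval v + y / 2 ^ length v) (int (length v) - int (length w))"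
    and "v \<noteq> [] \<Longrightarrow> w \<noteq> [] \<Longrightarrow> even_at f (wval v + y / 2 ^ length v) \<longleftrightarrow>
      (hd v \<longleftrightarrow> even (length v)) = (hd w \<longleftrightarrow> even (length w))"
proof -
  let ?x = "wval v + y / 2 ^ length v"
  have f: "f (wval v + z / 2 ^ length v) = wval w + z / 2 ^ length w" if "z \<in> {0..1}" for z
    using d k that unfolding tree_diagram_of_iff v w by blast
  have fx: "f ?x = wval w + y / 2 ^ length w" by (rule f) (use y in auto)
  show s: "has_rslope f ?x (int (length v) - int (length w))"
    unfolding has_rslope_def
  \<comment> \<open>The distance from ?x to the right end of the leaf interval.\<close>
  proof (intro exI[of _ "(1 - y) / 2 ^ length v"] conjI ballI)
    show "0 < (1 - y) / 2 ^ length v" using y by simp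
    show "?x + (1 - y) / 2 ^ length v \<le> 1" using wval_end_le[of v] by (simp add: diff_divide_distrib)
    fix u assume u: "u \<in> {?x..?x + (1 - y) / 2 ^ length v}"
    \<comment> \<open>The parameter of u within the leaf interval.\<close>
    let ?z = "y + (u - ?x) * 2 ^ length v"
    have "u - ?x \<le> (1 - y) / 2 ^ length v" using u by auto
    hence "(u - ?x) * 2 ^ length v \<le> 1 - y" by (simp add: pos_le_divide_eq)
    moreover have "0 \<le> (u - ?x) * 2 ^ length v" using u by auto
    ultimately have z: "?z \<in> {0..1}" using y unfolding atLeastAtMost_iff atLeastLessThan_iff by linarith
    have "u = wval v + ?z / 2 ^ length v" by (simp add: add_divide_distrib)
    hence "f u = wval w + ?z / 2 ^ length w" using f[OF z] by simp
    also have "\<dots> = f ?x + 2 powi (int (length v) - int (length w)) * (u - ?x)"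
      unfolding fx by (simp add: power_int_diff add_divide_distrib)
    finally show "f u = f ?x + 2 powi (int (length v) - int (length w)) * (u - ?x)" .
  qed
  show "even_at f ?x \<longleftrightarrow> (hd v \<longleftrightarrow> even (length v)) = (hd w \<longleftrightarrow> even (length w))"
    if "v \<noteq> []" "w \<noteq> []"
    using even_at_iff[OF s] wval_less_half_iff[OF that(1) y] wval_less_half_iff[OF that(2) y] fx by auto
qed

text \<open>Unlike in \<open>three_colorable\<close>, the root is treated as having an edge to a parent, which makes
  the notion compatible with passing to subtrees.\<close>

definition proper_coloring :: "bintree \<Rightarrow> (nat \<Rightarrow> 3) \<Rightarrow> bool" where
  "proper_coloring T c \<longleftrightarrow> (\<forall>v p q. v \<in> vertices T \<longrightarrow> p < q \<longrightarrow>
     {k. k < length (leaves T) \<and> prefix v (leaves T ! k)} = {p..<q} \<longrightarrow> c p \<noteq> c q)"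

lemma Nil_in_vertices: "[] \<in> vertices T"
  by (cases T) auto

lemma leaves_below_False:
  "{k. k < length (leaves (Caret l r)) \<and> prefix (False # v) (leaves (Caret l r) ! k)} =
   {k. k < length (leaves l) \<and> prefix v (leaves l ! k)}"
proof (rule Collect_cong)
  show "k < length (leaves (Caret l r)) \<and> prefix (False # v) (leaves (Caret l r) ! k) \<longleftrightarrow>
      k < length (leaves l) \<and> prefix v (leaves l ! k)" for k
    by (cases "k < length (leaves l)") (auto simp: nth_append)
qed

lemma leaves_below_True:
  "{k. k < length (leaves (Caret l r)) \<and> prefix (True # v) (leaves (Caret l r) ! k)} =
   (+) (length (leaves l)) ` {k. k < length (leaves r) \<and> prefix v (leaves r ! k)}" (is "?A = ?B")
proof
  show "?A \<subseteq> ?B"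
  proof
    fix k assume "k \<in> ?A"
    hence "length (leaves l) \<le> k" "k - length (leaves l) \<in> {k. k < length (leaves r) \<and> prefix v (leaves r ! k)}"
      by (auto simp: nth_append split: if_splits)
    thus "k \<in> ?B" by (intro image_eqI[of _ _ "k - length (leaves l)"]) auto
  qed
qed (auto simp: nth_append)

lemma proper_coloring_Leaf: "proper_coloring Leaf c \<longleftrightarrow> c 0 \<noteq> c 1"
proof -
  have "{k. k < length (leaves Leaf) \<and> prefix [] (leaves Leaf ! k)} = {0..<1::nat}" by auto
  moreover have "{0..<1} = {p..<q} \<longleftrightarrow> p = 0 \<and> q = 1" if "p < q" for p q :: nat
    using that atLeastLessThan_eq_iff[of 0 1 p q] by auto
  ultimately show ?thesis unfolding proper_coloring_def vertices.simps by (metis singleton_iff zero_less_one)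
qed

text \<open>Regions of the right subtree are renumbered by the number of leaves on the left. The
  assumption omits the root, so the lemma serves both for proper colorings and for whole diagrams,
  whose root carries no edge.\<close>

lemma subtree_coloring:
  assumes "\<And>v p q. v \<in> (Cons False) ` vertices l \<union> (Cons True) ` vertices r \<Longrightarrow> p < q \<Longrightarrow>
     {k. k < length (leaves (Caret l r)) \<and> prefix v (leaves (Caret l r) ! k)} = {p..<q} \<Longrightarrow> c p \<noteq> c q"
  shows "proper_coloring l c" "proper_coloring r (\<lambda>i. c (length (leaves l) + i))"
proof -
  show "proper_coloring l c" unfolding proper_coloring_def
  proof (intro allI impI)
    fix v p q assume *: "v \<in> vertices l" "p < q"
      "{k. k < length (leaves l) \<and> prefix v (leaves l ! k)} = {p..<q}"
    show "c p \<noteq> c q"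
      by (rule assms[of "False # v"]) (use * in \<open>simp_all only: leaves_below_False, auto\<close>)
  qed
  show "proper_coloring r (\<lambda>i. c (length (leaves l) + i))" unfolding proper_coloring_def
  proof (intro allI impI)
    fix v p q assume *: "v \<in> vertices r" "p < q"
      "{k. k < length (leaves r) \<and> prefix v (leaves r ! k)} = {p..<q}"
    show "c (length (leaves l) + p) \<noteq> c (length (leaves l) + q)"
      by (rule assms[of "True # v"])
        (use * in \<open>simp_all only: leaves_below_True image_add_atLeastLessThan, auto simp: add.commute\<close>)
  qed
qed

lemma subtree_coloring_rev:
  assumes l: "proper_coloring l c" and r: "proper_coloring r (\<lambda>i. c (length (leaves l) + i))"
    and v: "v \<in> (Cons False) ` vertices l \<union> (Cons True) ` vertices r" and pq: "p < q"
    "{k. k < length (leaves (Caret l r)) \<and> prefix v (leaves (Caret l r) ! k)} = {p..<q}"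
  shows "c p \<noteq> c q"
  using v
proof
  assume "v \<in> (Cons False) ` vertices l"
  then obtain u where u: "u \<in> vertices l" "v = False # u" by auto
  with pq have "{k. k < length (leaves l) \<and> prefix u (leaves l ! k)} = {p..<q}"
    by (simp only: leaves_below_False)
  with l u pq(1) show ?thesis unfolding proper_coloring_def by blast
next
  assume "v \<in> (Cons True) ` vertices r"
  then obtain u where u: "u \<in> vertices r" "v = True # u" by auto
  let ?n = "length (leaves l)"
  from pq u have eq: "(+) ?n ` {k. k < length (leaves r) \<and> prefix u (leaves r ! k)} = {p..<q}"
    by (simp only: leaves_below_True)
  moreover have "p \<in> {p..<q}" using pq by simp
  ultimately have p: "?n \<le> p" by (metis (no_types, lifting) imageE le_add1)
  have "{p..<q} = (+) ?n ` {p - ?n..<q - ?n}"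
    using p pq(1) by (simp add: image_add_atLeastLessThan)
  with eq have "(+) ?n ` {k. k < length (leaves r) \<and> prefix u (leaves r ! k)} = (+) ?n ` {p - ?n..<q - ?n}"
    by (rule trans)
  hence "{k. k < length (leaves r) \<and> prefix u (leaves r ! k)} = {p - ?n..<q - ?n}"
    by (rule inj_image_eq_iff[THEN iffD1, OF inj_on_add])
  moreover have "p - ?n < q - ?n" using p pq(1) by simp
  ultimately have "c (?n + (p - ?n)) \<noteq> c (?n + (q - ?n))"
    using r u(1) unfolding proper_coloring_def by blast
  thus ?thesis using p pq(1) by simp
qed

lemma proper_coloring_root:
  assumes "proper_coloring T c" shows "c 0 \<noteq> c (length (leaves T))"
proof -
  have "{k. k < length (leaves T) \<and> prefix [] (leaves T ! k)} = {0..<length (leaves T)}" by auto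
  moreover have "0 < length (leaves T)" using leaves_not_Nil by simp
  ultimately show ?thesis using assms Nil_in_vertices unfolding proper_coloring_def by blast
qed

lemma proper_coloring_Caret:
  "proper_coloring (Caret l r) c \<longleftrightarrow> c 0 \<noteq> c (length (leaves (Caret l r))) \<and>
     proper_coloring l c \<and> proper_coloring r (\<lambda>i. c (length (leaves l) + i))" (is "?P \<longleftrightarrow> ?R \<and> ?L")
proof
  assume P: ?P
  have "c p \<noteq> c q" if "v \<in> (Cons False) ` vertices l \<union> (Cons True) ` vertices r" "p < q"
    "{k. k < length (leaves (Caret l r)) \<and> prefix v (leaves (Caret l r) ! k)} = {p..<q}" for v p q
  proof -
    have "v \<in> vertices (Caret l r)" using that(1) by auto
    with P that(2,3) show ?thesis unfolding proper_coloring_def by blast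
  qed
  note key = this
  have ?L by (intro conjI subtree_coloring[of l r c]; erule (2) key)
  with proper_coloring_root[OF P] show "?R \<and> ?L" by (rule conjI)
next
  assume *: "?R \<and> ?L"
  show ?P unfolding proper_coloring_def
  proof (intro allI impI)
    fix v p q assume v: "v \<in> vertices (Caret l r)" and pq: "p < q"
      "{k. k < length (leaves (Caret l r)) \<and> prefix v (leaves (Caret l r) ! k)} = {p..<q}"
    show "c p \<noteq> c q"
    proof (cases "v = []")
      case True
      define n where "n = length (leaves (Caret l r))"
      have "{k. k < n \<and> prefix v (leaves (Caret l r) ! k)} = {0..<n}" using True by auto
      hence "{0..<n} = {p..<q}" using pq(2) unfolding n_def by (simp only:)
      moreover have "0 < n" using leaves_not_Nil[of "Caret l r"] unfolding n_def by blast
      ultimately have "p = 0" "q = n" using pq(1) atLeastLessThan_eq_iff[of 0 n p q] by auto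
      with * show ?thesis unfolding n_def by blast
    next
      case False
      with v have "v \<in> (Cons False) ` vertices l \<union> (Cons True) ` vertices r" by auto
      with * pq show ?thesis using subtree_coloring_rev by blast
    qed
  qed
qed

section \<open>Differences of colors modulo 3\<close>

text \<open>Nonzero elements of \<int> modulo 3 that do not cancel are equal, and doubling is
  negation.\<close>

lemma three_add_neg: "x \<noteq> 0 \<Longrightarrow> y \<noteq> 0 \<Longrightarrow> x + y \<noteq> 0 \<Longrightarrow> x = - (x + y) \<and> y = - (x + y)" for x y :: 3
proof -
  have "\<forall>x y :: 3. x \<noteq> 0 \<longrightarrow> y \<noteq> 0 \<longrightarrow> x + y \<noteq> 0 \<longrightarrow> x = - (x + y) \<and> y = - (x + y)"
    unfolding forall_3 by simp
  thus "x \<noteq> 0 \<Longrightarrow> y \<noteq> 0 \<Longrightarrow> x + y \<noteq> 0 \<Longrightarrow> x = - (x + y) \<and> y = - (x + y)" by blast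
qed

lemma three_double: "x + x = - x" for x :: 3
proof -
  have "\<forall>x :: 3. x + x = - x" unfolding forall_3 by simp
  thus ?thesis by blast
qed

lemma all_less_add_iff: "(\<forall>k < n + m. P k) \<longleftrightarrow> (\<forall>k < n. P k) \<and> (\<forall>k < m. P (n + k))" for n m :: nat
proof (intro iffI conjI allI impI)
  fix k assume *: "(\<forall>k < n. P k) \<and> (\<forall>k < m. P (n + k))" "k < n + m"
  show "P k"
  proof (cases "k < n")
    case False
    hence "k - n < m" using *(2) by linarith
    with * have "P (n + (k - n))" by blast
    with False show ?thesis by simp
  qed (use * in blast)
qed auto

text \<open>A third color is forced by two distinct ones, so descending one level in the tree negates the
  difference of the colors on the two sides of an edge.\<close>

definition depth_signed :: "bintree \<Rightarrow> (nat \<Rightarrow> 3) \<Rightarrow> 3 \<Rightarrow> bool" where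
  "depth_signed T c d \<longleftrightarrow> (\<forall>k < length (leaves T). c (Suc k) - c k = (-1) ^ length (leaves T ! k) * d)"

lemma depth_signed_Caret:
  "depth_signed (Caret l r) c d \<longleftrightarrow>
     depth_signed l c (- d) \<and> depth_signed r (\<lambda>i. c (length (leaves l) + i)) (- d)"
proof -
  show ?thesis unfolding depth_signed_def leaves.simps length_append length_map all_less_add_iff
    by (auto simp: nth_append)
qed

text \<open>Both subtrees contribute - d, and -2 d = d modulo 3.\<close>

lemma depth_signed_total: "depth_signed T c d \<Longrightarrow> c (length (leaves T)) - c 0 = d"
proof (induction T arbitrary: c d)
  case Leaf
  then show ?case by (simp add: depth_signed_def)
next
  case (Caret l r)
  let ?n = "length (leaves l)" and ?m = "length (leaves r)"
  have "c ?n - c 0 = - d" "c (?n + ?m) - c ?n = - d"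
    using Caret.IH(1)[of c "- d"] Caret.IH(2)[of "\<lambda>i. c (?n + i)" "- d"] Caret.prems
    by (simp_all add: depth_signed_Caret)
  hence "c (?n + ?m) - c 0 = - d + - d" by (metis diff_add_cancel add_diff_eq add.commute)
  also have "\<dots> = d" using three_double[of "- d"] by simp
  finally show ?case by simp
qed

lemma proper_coloring_iff_depth_signed:
  "proper_coloring T c \<longleftrightarrow> (\<exists>d. d \<noteq> 0 \<and> depth_signed T c d)"
proof (induction T arbitrary: c)
  case Leaf
  show ?case by (auto simp: proper_coloring_Leaf depth_signed_def)
next
  case (Caret l r)
  let ?n = "length (leaves l)" and ?m = "length (leaves r)"
  show ?case
  proof
    assume P: "proper_coloring (Caret l r) c"
    then obtain d e where d: "d \<noteq> 0" "depth_signed l c d" and e: "e \<noteq> 0" "depth_signed r (\<lambda>i. c (?n + i)) e"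
      using Caret.IH unfolding proper_coloring_Caret by blast
    have sum: "c (?n + ?m) - c 0 = d + e"
      using depth_signed_total[OF d(2)] depth_signed_total[OF e(2)] by (simp add: algebra_simps)
    have "c (?n + ?m) - c 0 \<noteq> 0" using P unfolding proper_coloring_Caret by auto
    with sum have ne: "d + e \<noteq> 0" by simp
    from three_add_neg[OF d(1) e(1) ne] have "d = - (d + e)" "e = - (d + e)" by auto
    hence "depth_signed (Caret l r) c (d + e)" using d(2) e(2) unfolding depth_signed_Caret by metis
    with ne show "\<exists>d. d \<noteq> 0 \<and> depth_signed (Caret l r) c d" by blast
  next
    assume "\<exists>d. d \<noteq> 0 \<and> depth_signed (Caret l r) c d"
    then obtain d where d: "d \<noteq> 0" "depth_signed (Caret l r) c d" by blast
    hence "- d \<noteq> 0" "depth_signed l c (- d)" "depth_signed r (\<lambda>i. c (?n + i)) (- d)"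
      by (simp_all add: depth_signed_Caret)
    hence "proper_coloring l c" "proper_coloring r (\<lambda>i. c (?n + i))" using Caret.IH by blast+
    moreover have "c 0 \<noteq> c (length (leaves (Caret l r)))"
      using depth_signed_total[OF d(2)] d(1) by auto
    ultimately show "proper_coloring (Caret l r) c" unfolding proper_coloring_Caret by blast
  qed
qed

text \<open>In terms of the remaining word w, a leaf 0w gets the sign \<open>(-1) ^ length w\<close>
  and a leaf 1w the opposite one. Only nonempty words are meant.\<close>

definition word_sign :: "bool list \<Rightarrow> 3" where
  "word_sign w = (if hd w = even (length w) then 1 else - 1)"

lemma word_sign_eq_iff: "word_sign v = word_sign w \<longleftrightarrow> (hd v = even (length v)) = (hd w = even (length w))"
proof -
  have "(1::3) \<noteq> - 1" by simp
  thus ?thesis unfolding word_sign_def by (auto split: if_splits)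
qed

text \<open>The two subtrees below the root are properly colored, each with its own total
  difference. Since the first and the last region coincide, these totals cancel: they are d and - d.
  This is the source of the extra sign on the right half.\<close>

lemma edge_coloring_iff_word_sign:
  assumes "T \<noteq> Leaf"
  shows "c 0 = c (length (leaves T)) \<and> (\<forall>v p q. edge_separates T v p q \<longrightarrow> c p \<noteq> c q) \<longleftrightarrow>
    (\<exists>d. d \<noteq> 0 \<and> (\<forall>k < length (leaves T). c (Suc k) - c k = word_sign (leaves T ! k) * d))"
    (is "?L \<longleftrightarrow> (\<exists>d. d \<noteq> 0 \<and> ?R d)")
proof -
  obtain l r where T: "T = Caret l r" using assms by (cases T) auto
  let ?n = "length (leaves l)" and ?m = "length (leaves r)"
  have edges: "(\<forall>v p q. edge_separates T v p q \<longrightarrow> c p \<noteq> c q) \<longleftrightarrow>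
      proper_coloring l c \<and> proper_coloring r (\<lambda>i. c (?n + i))"
  proof
    assume *: "\<forall>v p q. edge_separates T v p q \<longrightarrow> c p \<noteq> c q"
    have "c p \<noteq> c q" if "v \<in> (Cons False) ` vertices l \<union> (Cons True) ` vertices r" "p < q"
      "{k. k < length (leaves (Caret l r)) \<and> prefix v (leaves (Caret l r) ! k)} = {p..<q}" for v p q
    proof -
      have "v \<in> vertices T" "v \<noteq> []" using that(1) unfolding T by auto
      with * that show ?thesis unfolding edge_separates_def T by blast
    qed
    note key = this
    show "proper_coloring l c \<and> proper_coloring r (\<lambda>i. c (?n + i))"
      by (intro conjI subtree_coloring[of l r c]; erule (2) key)
  next
    assume *: "proper_coloring l c \<and> proper_coloring r (\<lambda>i. c (?n + i))"
    show "\<forall>v p q. edge_separates T v p q \<longrightarrow> c p \<noteq> c q"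
    proof (intro allI impI)
      fix v p q assume e: "edge_separates T v p q"
      hence "v \<in> (Cons False) ` vertices l \<union> (Cons True) ` vertices r"
        unfolding edge_separates_def T by auto
      with e * show "c p \<noteq> c q" unfolding edge_separates_def T using subtree_coloring_rev by blast
    qed
  qed
  have R: "?R d \<longleftrightarrow> depth_signed l c d \<and> depth_signed r (\<lambda>i. c (?n + i)) (- d)" for d
  proof -
    have 0: "word_sign (False # w) = (-1) ^ length w" "word_sign (True # w) = - ((-1) ^ length w)" for w
      by (cases "even (length w)"; simp add: word_sign_def)+
    show ?thesis unfolding T depth_signed_def leaves.simps length_append length_map all_less_add_iff
      by (auto simp: nth_append 0)
  qed
  show ?thesis
  proof
    assume L: ?L
    hence "proper_coloring l c" "proper_coloring r (\<lambda>i. c (?n + i))" using edges by blast+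
    then obtain d e where d: "d \<noteq> 0" "depth_signed l c d" and e: "e \<noteq> 0" "depth_signed r (\<lambda>i. c (?n + i)) e"
      unfolding proper_coloring_iff_depth_signed by (elim exE conjE)
    have "c (?n + ?m) - c 0 = d + e"
      using depth_signed_total[OF d(2)] depth_signed_total[OF e(2)] by (simp add: algebra_simps)
    moreover have "c (?n + ?m) - c 0 = 0" using L by (simp add: T)
    ultimately have "e = - d" by (simp add: eq_neg_iff_add_eq_0 add.commute)
    with d e R show "\<exists>d. d \<noteq> 0 \<and> ?R d" by blast
  next
    assume "\<exists>d. d \<noteq> 0 \<and> ?R d"
    then obtain d where d: "d \<noteq> 0" "depth_signed l c d" "depth_signed r (\<lambda>i. c (?n + i)) (- d)"
      using R by blast
    have "- d \<noteq> 0" using d(1) by simp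
    with d have "proper_coloring l c \<and> proper_coloring r (\<lambda>i. c (?n + i))"
      using proper_coloring_iff_depth_signed by blast
    moreover have "c 0 = c (length (leaves T))"
      using depth_signed_total[OF d(2)] depth_signed_total[OF d(3)] by (simp add: T algebra_simps)
    ultimately show ?L using edges by blast
  qed
qed

text \<open>Each tree fixes the differences of colors up to a nonzero factor modulo 3. A common
  coloring therefore exists exactly if the two sign patterns agree up to one global sign.\<close>

lemma three_colorable_iff:
  assumes ne: "Tp \<noteq> Leaf" "Tm \<noteq> Leaf" and len: "length (leaves Tp) = length (leaves Tm)"
  shows "three_colorable Tp Tm \<longleftrightarrow>
    (\<exists>e \<in> {1, - 1}. \<forall>k < length (leaves Tp). word_sign (leaves Tp ! k) = e * word_sign (leaves Tm ! k))"
proof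
  assume "three_colorable Tp Tm"
  then obtain c :: "nat \<Rightarrow> 3" where c0: "c 0 = c (length (leaves Tp))"
    "\<forall>v p q. edge_separates Tp v p q \<or> edge_separates Tm v p q \<longrightarrow> c p \<noteq> c q"
    unfolding three_colorable_def by blast
  have c: "c 0 = c (length (leaves Tp)) \<and> (\<forall>v p q. edge_separates Tp v p q \<longrightarrow> c p \<noteq> c q)"
    "c 0 = c (length (leaves Tm)) \<and> (\<forall>v p q. edge_separates Tm v p q \<longrightarrow> c p \<noteq> c q)"
  proof -
    have e: "c p \<noteq> c q" if "edge_separates Tp v p q \<or> edge_separates Tm v p q" for v p q
      using c0(2) that by blast
    show "c 0 = c (length (leaves Tp)) \<and> (\<forall>v p q. edge_separates Tp v p q \<longrightarrow> c p \<noteq> c q)"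
      using c0(1) e by metis
    show "c 0 = c (length (leaves Tm)) \<and> (\<forall>v p q. edge_separates Tm v p q \<longrightarrow> c p \<noteq> c q)"
      using c0(1) e unfolding len by metis
  qed
  obtain d where d: "d \<noteq> 0" "\<forall>k < length (leaves Tp). c (Suc k) - c k = word_sign (leaves Tp ! k) * d"
    using edge_coloring_iff_word_sign[OF ne(1), of c, THEN iffD1, OF c(1)] by (elim exE conjE)
  obtain e where e: "e \<noteq> 0" "\<forall>k < length (leaves Tm). c (Suc k) - c k = word_sign (leaves Tm ! k) * e"
    using edge_coloring_iff_word_sign[OF ne(2), of c, THEN iffD1, OF c(2)] by (elim exE conjE)
  \<comment> \<open>Nonzero elements are their own inverses, so e * d is the quotient of the two
    factors.\<close>
  have "\<forall>d::3. d \<noteq> 0 \<longrightarrow> d * d = 1" unfolding forall_3 by simp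
  hence dd: "d * d = 1" using d(1) by blast
  have "\<forall>d e::3. d \<noteq> 0 \<longrightarrow> e \<noteq> 0 \<longrightarrow> e * d \<in> {1, -1}" unfolding forall_3 by simp
  hence ed: "e * d \<in> {1, -1}" using d(1) e(1) by blast
  have "word_sign (leaves Tp ! k) = (e * d) * word_sign (leaves Tm ! k)" if "k < length (leaves Tp)" for k
  proof -
    have "word_sign (leaves Tp ! k) * d = word_sign (leaves Tm ! k) * e" using d e len that by metis
    hence "word_sign (leaves Tp ! k) * (d * d) = word_sign (leaves Tm ! k) * e * d"
      by (simp flip: mult.assoc)
    thus ?thesis unfolding dd by (simp add: ac_simps)
  qed
  with ed show "\<exists>e \<in> {1, - 1}. \<forall>k < length (leaves Tp). word_sign (leaves Tp ! k) = e * word_sign (leaves Tm ! k)"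
    by blast
next
  assume "\<exists>e \<in> {1, - 1}. \<forall>k < length (leaves Tp). word_sign (leaves Tp ! k) = e * word_sign (leaves Tm ! k)"
  then obtain e where e: "e \<in> {1, -1}" "\<forall>k < length (leaves Tp). word_sign (leaves Tp ! k) = e * word_sign (leaves Tm ! k)"
    by blast
  \<comment> \<open>Partial sums of the signs of Tp: the factor is 1 for Tp and e for Tm.\<close>
  define c where "c i = (\<Sum>k<i. word_sign (leaves Tp ! k))" for i
  have "\<exists>d. d \<noteq> 0 \<and> (\<forall>k < length (leaves Tp). c (Suc k) - c k = word_sign (leaves Tp ! k) * d)"
    by (rule exI[of _ 1]) (simp add: c_def)
  moreover have "e \<noteq> 0" using e(1) by auto
  hence "\<exists>d. d \<noteq> 0 \<and> (\<forall>k < length (leaves Tm). c (Suc k) - c k = word_sign (leaves Tm ! k) * d)"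
    using e(2) len by (intro exI[of _ e]) (simp add: c_def mult.commute)
  ultimately show "three_colorable Tp Tm"
    using edge_coloring_iff_word_sign[OF ne(1), of c] edge_coloring_iff_word_sign[OF ne(2), of c]
    unfolding three_colorable_def by metis
qed

subsection \<open>Existence of tree diagrams\<close>

text \<open>The standard dyadic intervals of the words, in this order, tile the interval from a to
  b.\<close>

fun word_chain :: "real \<Rightarrow> bool list list \<Rightarrow> real \<Rightarrow> bool" where
  "word_chain a [] b \<longleftrightarrow> a = b"
| "word_chain a (w # ws) b \<longleftrightarrow> wval w = a \<and> word_chain (a + 1 / 2 ^ length w) ws b"

lemma word_chain_append: "word_chain a (us @ vs) b \<longleftrightarrow> (\<exists>m. word_chain a us m \<and> word_chain m vs b)"
  by (induction us arbitrary: a) auto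

lemma word_chain_le: "word_chain a ws b \<Longrightarrow> a \<le> b"
proof (induction ws arbitrary: a)
  case (Cons w ws)
  have "0 \<le> 1 / (2::real) ^ length w" by simp
  moreover have "a + 1 / 2 ^ length w \<le> b" using Cons by simp
  ultimately show ?case by linarith
qed simp

lemma word_chain_end_le: "word_chain a ws b \<Longrightarrow> a \<le> 1 \<Longrightarrow> b \<le> 1"
proof (induction ws arbitrary: a)
  case (Cons w ws)
  then show ?case using wval_end_le[of w] by auto
qed simp

lemma word_chain_map_Cons: "word_chain a (map (Cons d) ws) b \<longleftrightarrow> word_chain (2 * a - of_bool d) ws (2 * b - of_bool d)"
proof (induction ws arbitrary: a)
  case (Cons w ws)
  have "2 * (a + 1 / 2 ^ Suc (length w)) - of_bool d = 2 * a - of_bool d + 1 / 2 ^ length w" by simp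
  moreover have "wval (d # w) = a \<longleftrightarrow> wval w = 2 * a - of_bool d" by auto
  ultimately show ?case using Cons[of "a + 1 / 2 ^ Suc (length w)"]
    unfolding list.map word_chain.simps list.size by (simp only: add_0_right add_Suc_right)
qed auto

text \<open>No interval of a nonempty word straddles 1/2, and left ends increase along the chain. A
  word beginning with 0 cannot come after one beginning with 1.\<close>

lemma word_chain_split_first_digit:
  assumes "word_chain a ws b" "[] \<notin> set ws"
  shows "\<exists>us vs. ws = map (Cons False) us @ map (Cons True) vs"
  using assms
proof (induction ws arbitrary: a)
  case Nil
  then show ?case by simp
next
  case (Cons w ws)
  have "word_chain (a + 1 / 2 ^ length w) ws b" "[] \<notin> set ws" using Cons.prems by simp_all
  from Cons.IH[OF this] obtain us vs where uv: "ws = map (Cons False) us @ map (Cons True) vs" by blast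
  obtain d w' where w: "w = d # w'" using Cons.prems by (cases w) auto
  show ?case
  proof (cases d)
    case False
    have "w # ws = map (Cons False) (w' # us) @ map (Cons True) vs" using uv w False by simp
    thus ?thesis by blast
  next
    case True
    have "us = []"
    proof (cases us)
      case (Cons u us')
      have "wval (False # u) = a + 1 / 2 ^ length w" "wval w = a"
        using Cons.prems(1) uv Cons by auto
      moreover have "1/2 \<le> wval w" using w True wval_nonneg[of w'] by simp
      moreover have "wval (False # u) < 1/2" using wval_lt_1[of u] by simp
      moreover have "0 < 1 / (2::real) ^ length w" by simp
      ultimately show ?thesis by linarith
    qed
    hence "w # ws = map (Cons False) [] @ map (Cons True) (w' # vs)" using uv w True by simp
    thus ?thesis by blast
  qed
qed

text \<open>Induction on a bound for the word lengths. The empty word fills the unit interval alone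
  and gives \<open>Leaf\<close>; otherwise the tiling splits at 1/2, and both halves rescale to
  tilings by shorter words.\<close>

lemma word_chain_imp_tree:
  assumes "word_chain 0 ws 1" shows "\<exists>T. leaves T = ws"
proof -
  have "\<exists>T. leaves T = ws" if "word_chain 0 ws 1" "\<forall>w\<in>set ws. length w \<le> n" for n
    using that
  proof (induction n arbitrary: ws)
    case 0
    show ?case
    proof (cases ws)
      case (Cons w ws')
      with 0 have "w = []" "word_chain 1 ws' 1" by auto
      moreover have "ws' = []" using \<open>word_chain 1 ws' 1\<close> wval_lt_1 by (cases ws') (auto simp: less_le)
      ultimately have "leaves Leaf = ws" using Cons by simp
      thus ?thesis by blast
    qed (use 0 in simp)
  next
    case (Suc n)
    show ?case
    proof (cases "[] \<in> set ws")
      case True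
      then obtain us vs where ws: "ws = us @ [] # vs" by (auto simp: in_set_conv_decomp)
      with Suc.prems(1) have c: "word_chain 0 us 0" "word_chain 1 vs 1" by (auto simp: word_chain_append)
      have "us = []"
      proof (cases us)
        case (Cons u us')
        with c(1) have "word_chain (0 + 1 / 2 ^ length u) us' 0" by simp
        hence "0 + 1 / (2::real) ^ length u \<le> 0" by (rule word_chain_le)
        moreover have "0 < 1 / (2::real) ^ length u" by simp
        ultimately show ?thesis by linarith
      qed
      moreover have "vs = []" using c(2) wval_lt_1 by (cases vs) (auto simp: less_le)
      ultimately have "leaves Leaf = ws" using ws by simp
      thus ?thesis by blast
    next
      case False
      then obtain us vs where ws: "ws = map (Cons False) us @ map (Cons True) vs"
        using word_chain_split_first_digit Suc.prems(1) by blast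
      \<comment> \<open>The two groups of intervals meet at m. Rescaled left words end at 1 or
        earlier and rescaled right words start at 0 or later, which pins m to 1/2.\<close>
      obtain m where m: "word_chain 0 us (2 * m)" "word_chain (2 * m - 1) vs 1"
        using Suc.prems(1) unfolding ws word_chain_append word_chain_map_Cons by auto
      have "2 * m \<le> 1" using word_chain_end_le[OF m(1)] by simp
      moreover have "0 \<le> 2 * m - 1"
      proof (cases vs)
        case Nil
        with m have "m = 1" by simp
        with \<open>2 * m \<le> 1\<close> show ?thesis by simp
      next
        case (Cons v vs')
        with m have "wval v = 2 * m - 1" by simp
        thus ?thesis using wval_nonneg[of v] by simp
      qed
      ultimately have "2 * m = 1" by linarith
      with m have c: "word_chain 0 us 1" "word_chain 0 vs 1" by auto
      have n: "\<forall>u\<in>set us. length u \<le> n" "\<forall>v\<in>set vs. length v \<le> n"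
        using Suc.prems(2) unfolding ws by (auto simp: ball_Un)
      obtain l where "leaves l = us" using Suc.IH[OF c(1) n(1)] by blast
      moreover obtain r where "leaves r = vs" using Suc.IH[OF c(2) n(2)] by blast
      ultimately have "leaves (Caret l r) = ws" using ws by simp
      thus ?thesis by blast
    qed
  qed
  moreover have "\<forall>w\<in>set ws. length w \<le> Max (insert 0 (length ` set ws))" by simp
  ultimately show ?thesis using assms by blast
qed

text \<open>The standard dyadic interval of \<open>v\<close> can be cut, along a tree, into standard dyadic intervals
  which \<open>f\<close> maps affinely onto standard dyadic intervals.\<close>

definition subdivides :: "(real \<Rightarrow> real) \<Rightarrow> bool list \<Rightarrow> bool" where
  "subdivides f v \<longleftrightarrow> (\<exists>T ws.
     list_all2 (\<lambda>u w. \<forall>y\<in>{0..1}. f (wval (v @ u) + y / 2 ^ length (v @ u)) = wval w + y / 2 ^ length w) (leaves T) ws \<and>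
     word_chain (f (wval v)) ws (f (wval v + 1 / 2 ^ length v)))"

lemma wval_snoc: "wval (v @ [d]) = wval v + of_bool d / 2 ^ Suc (length v)"
  by (simp add: wval_append)

lemma subdivides_Caret:
  assumes "subdivides f (v @ [False])" "subdivides f (v @ [True])"
  shows "subdivides f v"
proof -
  let ?P = "\<lambda>v u w. \<forall>y\<in>{0..1}. f (wval (v @ u) + y / 2 ^ length (v @ u)) = wval w + y / 2 ^ length w"
  obtain l ws where l: "list_all2 (?P (v @ [False])) (leaves l) ws"
    "word_chain (f (wval (v @ [False]))) ws (f (wval (v @ [False]) + 1 / 2 ^ length (v @ [False])))"
    using assms(1) unfolding subdivides_def by blast
  obtain r zs where r: "list_all2 (?P (v @ [True])) (leaves r) zs"
    "word_chain (f (wval (v @ [True]))) zs (f (wval (v @ [True]) + 1 / 2 ^ length (v @ [True])))"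
    using assms(2) unfolding subdivides_def by blast
  have "list_all2 (?P v) (leaves (Caret l r)) (ws @ zs)"
    using l(1) r(1) by (auto simp: list_all2_map1 intro!: list_all2_appendI)
  moreover have "word_chain (f (wval v)) (ws @ zs) (f (wval v + 1 / 2 ^ length v))"
  proof -
    have "wval v + 1 / 2 ^ Suc (length v) + 1 / 2 ^ Suc (length v) = wval v + 1 / 2 ^ length v" by simp
    moreover have "word_chain (f (wval v)) ws (f (wval v + 1 / 2 ^ Suc (length v)))"
      using l(2) unfolding wval_snoc by simp
    moreover have "word_chain (f (wval v + 1 / 2 ^ Suc (length v))) zs
        (f (wval v + 1 / 2 ^ Suc (length v) + 1 / 2 ^ Suc (length v)))"
      using r(2) unfolding wval_snoc by (simp only: of_bool_eq length_append_singleton)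
    ultimately show ?thesis unfolding word_chain_append by metis
  qed
  ultimately show ?thesis unfolding subdivides_def by blast
qed

text \<open>After L further bisections the image intervals have length 1/2^p, and their left ends
  are multiples of 1/2^p in [0,1), so they are standard. Each bisection lengthens v and lowers L,
  leaving p fixed.\<close>

lemma subdivides_affine:
  fixes f :: "real \<Rightarrow> real" and j :: int
  assumes unit: "\<And>w. 0 \<le> f (wval w) \<and> f (wval w) < 1"
    and "\<And>y. 0 \<le> y \<Longrightarrow> y \<le> 1 \<Longrightarrow> f (wval v + y / 2 ^ length v) = f (wval v) + 2 powi (j - int (length v)) * y"
    and "int p = int (length v) + int L - j" and "f (wval v) = of_int m / 2 ^ p"
  shows "subdivides f v"
  using assms(2-)
proof (induction L arbitrary: v m)
  case 0
  have "0 \<le> of_int m / (2::real) ^ p" "of_int m / (2::real) ^ p < 1"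
    using unit[of v] 0(3) by auto
  hence "\<not> m < 0" "of_int m < (2::real) ^ p" using divide_neg_pos[of "of_int m" "(2::real) ^ p"] by auto
  hence "0 \<le> m" "m < 2 ^ p" by (simp, metis of_int_less_iff of_int_power of_int_numeral)
  then obtain w where w: "length w = p" "wval w = of_int m / 2 ^ p" using wval_surj by blast
  have pw: "2 powi (j - int (length v)) = (1 / 2 ^ p :: real)"
  proof -
    have "j - int (length v) = - int p" using 0(2) by simp
    thus ?thesis by (simp add: power_int_minus divide_inverse)
  qed
  have *: "f (wval v + y / 2 ^ length v) = wval w + y / 2 ^ length w" if "0 \<le> y" "y \<le> 1" for y
    using 0(1)[OF that] 0(3) w pw by simp
  have "list_all2 (\<lambda>u w. \<forall>y\<in>{0..1}. f (wval (v @ u) + y / 2 ^ length (v @ u)) = wval w + y / 2 ^ length w) (leaves Leaf) [w]"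
    using * by simp
  moreover have "word_chain (f (wval v)) [w] (f (wval v + 1 / 2 ^ length v))"
    using *[of 0] *[of 1] by simp
  ultimately show ?case unfolding subdivides_def by blast
next
  case (Suc L)
  let ?s = "2 powi (j - int (length v) - 1) :: real"
  have s: "2 powi (j - int (length v)) = 2 * ?s" using power_int_add_1[of "2::real" "j - int (length v) - 1"] by simp
  have sj: "?s = 2 powi (j - int (length (v @ [d])))" for d
    by (rule arg_cong[of _ _ "\<lambda>k. 2 powi k"]) simp
  have len: "int p = int (length (v @ [d])) + int L - j" for d using Suc.prems(2) by simp
  have mid: "f (wval v + 1 / 2 ^ Suc (length v)) = f (wval v) + ?s"
    using Suc.prems(1)[of "1/2"] s by simp
  have "subdivides f (v @ [False])"
  proof (rule Suc.IH[OF _ len])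
    show "f (wval (v @ [False])) = of_int m / 2 ^ p" using Suc.prems(3) by (simp add: wval_snoc)
    show "f (wval (v @ [False]) + y / 2 ^ length (v @ [False])) =
        f (wval (v @ [False])) + 2 powi (j - int (length (v @ [False]))) * y" if "0 \<le> y" "y \<le> 1" for y
      using Suc.prems(1)[of "y/2"] that s unfolding sj[symmetric] by (simp add: wval_snoc)
  qed
  moreover have "subdivides f (v @ [True])"
  proof (rule Suc.IH[OF _ len])
    have "?s = 2 powi (int L - int p)"
      by (rule arg_cong[of _ _ "\<lambda>k. 2 powi k"]) (use Suc.prems(2) in simp)
    also have "\<dots> = 2 ^ L / 2 ^ p" by (simp add: power_int_diff)
    finally have "?s = 2 ^ L / 2 ^ p" .
    thus "f (wval (v @ [True])) = of_int (m + 2 ^ L) / 2 ^ p"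
      using mid Suc.prems(3) by (simp add: wval_snoc add_divide_distrib)
    show "f (wval (v @ [True]) + y / 2 ^ length (v @ [True])) =
        f (wval (v @ [True])) + 2 powi (j - int (length (v @ [True]))) * y" if "0 \<le> y" "y \<le> 1" for y
    proof -
      have "wval (v @ [True]) + y / 2 ^ length (v @ [True]) = wval v + ((1 + y) / 2) / 2 ^ length v"
        by (simp add: wval_snoc add_divide_distrib)
      hence "f (wval (v @ [True]) + y / 2 ^ length (v @ [True])) = f (wval v) + 2 * ?s * ((1 + y) / 2)"
        using Suc.prems(1)[of "(1 + y) / 2"] that s by simp
      also have "\<dots> = f (wval v) + ?s + ?s * y" by (simp add: field_simps)
      also have "f (wval v) + ?s = f (wval (v @ [True]))" using mid by (simp add: wval_snoc)
      finally show ?thesis unfolding sj[of True, symmetric] .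
    qed
  qed
  ultimately show ?case by (rule subdivides_Caret)
qed

lemma dyadic_common_denominator:
  assumes "finite D" "D \<subseteq> dyadic_rationals"
  shows "\<exists>n. \<forall>d\<in>D. \<exists>m::int. d = of_int m / 2 ^ n"
  using assms
proof (induction D rule: finite_induct)
  case (insert d D)
  then obtain n where n: "\<forall>d\<in>D. \<exists>m::int. d = of_int m / 2 ^ n" by auto
  obtain a k where d: "d = of_int a / 2 ^ k" using insert.prems by (auto simp: dyadic_rationals_def)
  have "\<exists>m::int. e = of_int m / 2 ^ (n + k)" if "e \<in> insert d D" for e
  proof (cases "e = d")
    case True
    have "d = of_int (a * 2 ^ n) / 2 ^ (n + k)" by (simp add: d power_add)
    with True show ?thesis by blast
  next
    case False
    with n that obtain m :: int where "e = of_int m / 2 ^ n" by auto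
    hence "e = of_int (m * 2 ^ k) / 2 ^ (n + k)" by (simp add: power_add)
    thus ?thesis by blast
  qed
  thus ?case by blast
qed simp

text \<open>At a depth n for which all breaks are multiples of 1/2^n, no break lies inside a
  standard interval, so \<open>subdivides_affine\<close> applies. Carets glue the pieces up to the
  root, and the image words tile the unit interval and hence are the leaves of a tree.\<close>

lemma thompson_F_tree_diagram:
  assumes f: "f \<in> carrier thompson_F"
  shows "\<exists>Tp Tm. tree_diagram_of Tp Tm f"
proof -
  obtain D where D: "finite D" "D \<subseteq> dyadic_rationals" "affine_off D f"
    using thompson_F_breaks[OF f] by blast
  obtain n where n: "\<forall>d\<in>D. \<exists>m::int. d = of_int m / 2 ^ n"
    using dyadic_common_denominator[OF D(1,2)] by blast
  have w01: "wval w \<in> {0..<1}" for w using wval_nonneg wval_lt_1 by simp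
  have unit: "0 \<le> f (wval w) \<and> f (wval w) < 1" for w
    using thompson_F_range_less[OF f w01] by simp
  have base: "subdivides f v" if v: "length v = n" for v
  proof -
    obtain i :: int where i: "wval v = of_int i / 2 ^ n" using wval_numerator[of v] v by auto
    have gap: "{wval v<..<wval v + 1 / 2 ^ length v} \<inter> D = {}"
    proof (rule ccontr)
      assume "\<not> ?thesis"
      then obtain d where d: "d \<in> D" "wval v < d" "d < wval v + 1 / 2 ^ n" using v by auto
      obtain m :: int where m: "d = of_int m / 2 ^ n" using n d(1) by blast
      have "wval v + 1 / 2 ^ n = of_int (i + 1) / 2 ^ n" by (simp add: i add_divide_distrib)
      with d(2,3) have "(of_int i :: real) < of_int m" "(of_int m :: real) < of_int (i + 1)"
        unfolding i m by (simp_all add: divide_less_cancel del: of_int_add)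
      thus False unfolding of_int_less_iff by simp
    qed
    have "wval v < wval v + 1 / 2 ^ length v" by simp
    from affine_offE[OF D(3) wval_nonneg this wval_end_le gap]
    obtain j :: int where j: "\<And>x. wval v \<le> x \<Longrightarrow> x \<le> wval v + 1 / 2 ^ length v \<Longrightarrow>
        f x = f (wval v) + 2 powi j * (x - wval v)" by metis
    have "wval v \<in> dyadic_rationals" unfolding dyadic_rationals_def i by blast
    hence "f (wval v) \<in> dyadic_rationals"
      using thompson_F_dyadic_iff[OF f, of "wval v"] w01[of v] by auto
    then obtain a :: int and e where a: "f (wval v) = of_int a / 2 ^ e" by (auto simp: dyadic_rationals_def)
    \<comment> \<open>Large enough that p is a natural number with e \<le> p, so that f (wval v) is
      a multiple of 1/2^p.\<close>
    define L where "L = e + nat \<bar>j\<bar>"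
    define p where "p = nat (int (length v) + int L - j)"
    have p: "int p = int (length v) + int L - j" "e \<le> p" by (simp_all add: p_def L_def)
    show ?thesis
    proof (rule subdivides_affine[where p = p and L = L and j = j and m = "a * 2 ^ (p - e)"])
      show "0 \<le> f (wval w) \<and> f (wval w) < 1" for w by (rule unit)
      show "int p = int (length v) + int L - j" by (rule p)
      have "(2::real) ^ p = 2 ^ (p - e) * 2 ^ e" using p(2) by (simp flip: power_add)
      thus "f (wval v) = of_int (a * 2 ^ (p - e)) / 2 ^ p" by (simp add: a)
      show "f (wval v + y / 2 ^ length v) = f (wval v) + 2 powi (j - int (length v)) * y"
        if "0 \<le> y" "y \<le> 1" for y
        using j[of "wval v + y / 2 ^ length v"] that by (simp add: divide_right_mono power_int_diff)
    qed
  qed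
  have "subdivides f v" if "length v + k = n" for k v
    using that
  proof (induction k arbitrary: v)
    case (Suc k)
    show ?case by (rule subdivides_Caret; rule Suc.IH) (use Suc.prems in auto)
  qed (use base in simp)
  from this[of "[]" n] obtain Tp ws where
    a: "list_all2 (\<lambda>u w. \<forall>y\<in>{0..1}. f (wval u + y / 2 ^ length u) = wval w + y / 2 ^ length w) (leaves Tp) ws"
    and c: "word_chain (f 0) ws (f 1)"
    unfolding subdivides_def by auto
  obtain Tm where "leaves Tm = ws"
    using word_chain_imp_tree c unfolding thompson_F_0[OF f] thompson_F_1[OF f] by blast
  with a have "tree_diagram_of Tp Tm f"
    unfolding tree_diagram_of_iff by (auto simp: list_all2_conv_all_nth)
  thus ?thesis by blast
qed

section \<open>The even part of the planar 3-colorable subgroup\<close>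

lemma has_rslope_derivative:
  assumes "has_rslope f x k" "x \<in> {0..<1}"
  shows "(f has_real_derivative 2 powi k) (at x within {x..1})"
proof -
  obtain e where e: "0 < e" "x + e \<le> 1" "\<forall>y\<in>{x..x+e}. f y = f x + 2 powi k * (y - x)"
    using assms(1) unfolding has_rslope_def by blast
  have "((\<lambda>y. f x + 2 powi k * (y - x)) has_real_derivative 2 powi k) (at x within {x..1})"
    by (auto intro!: derivative_eq_intros)
  thus ?thesis
  proof (rule has_field_derivative_transform_within[OF _ e(1)])
    show "x \<in> {x..1}" using assms(2) by auto
    fix y assume y: "y \<in> {x..1}" "dist y x < e"
    hence "y \<in> {x..x+e}" by (auto simp: dist_real_def)
    from bspec[OF e(3) this] show "f x + 2 powi k * (y - x) = f y" by (rule sym)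
  qed
qed

lemma log2_powi: "log 2 (2 powi k) = of_int k"
  using powr_real_of_int'[of 2 k] log_powr_cancel[of 2 "of_int k"] by simp

lemma rslope_at_0_even:
  assumes s: "has_rslope f 0 j"
    and d: "(f has_real_derivative d) (at 0 within {0..1})" "log 2 d = 2 * of_int k"
  shows "even j"
proof -
  have "(f has_real_derivative 2 powi j) (at 0 within {0..1})"
    using has_rslope_derivative[OF s] by simp
  with d(1) have "d = 2 powi j" unfolding has_field_derivative_iff
    by (rule tendsto_unique[rotated]) (simp add: at_within_Icc_at_right)
  hence "of_int j = (2 * of_int k :: real)" using d(2) log2_powi by simp
  hence "j = 2 * k" by linarith
  thus ?thesis by simp
qed

text \<open>The cocycle is not defined at 1, so the slope there is observed at a point b beyond the
  breaks below 1. Taking b beyond 1/2 and its preimage h as well puts b and f b on the same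
  side.\<close>

lemma thompson_F_last_slope:
  assumes f: "f \<in> carrier thompson_F"
  obtains b k where "1/2 \<le> b" "1/2 \<le> f b" "b < 1" "\<And>x. b \<le> x \<Longrightarrow> x \<le> 1 \<Longrightarrow> f x = f b + 2 powi k * (x - b)"
proof -
  obtain D where D: "finite D" "affine_off D f" using thompson_F_breaks[OF f] by metis
  have "1/2 \<in> f ` {0..1::real}" unfolding thompson_F_image[OF f] by simp
  then obtain h where h: "h \<in> {0..1}" "f h = 1/2" by force
  have h1: "h < 1" using h thompson_F_1[OF f] by (cases "h = 1") auto
  define b where "b = Max (insert (max (1/2) h) {d \<in> D. d < 1})"
  have fin: "finite (insert (max (1/2) h) {d \<in> D. d < 1})" using D by simp
  have b: "max (1/2) h \<le> b" "b < 1"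
    using Max_ge[OF fin insertI1] fin h1 unfolding b_def by simp_all
  have gap: "{b<..<1} \<inter> D = {}" unfolding b_def using Max_ge[OF fin] by (force simp: disjoint_iff)
  have b01: "b \<in> {0..1}" using b by auto
  have fb: "1/2 \<le> f b" using thompson_F_less_iff[OF f b01 h(1)] h(2) b(1) by auto
  have b0: "0 \<le> b" using b01 by simp
  obtain k :: int where k: "\<And>x. b \<le> x \<Longrightarrow> x \<le> 1 \<Longrightarrow> f x = f b + 2 powi k * (x - b)"
    using affine_offE[OF D(2) b0 b(2) order_refl gap] by metis
  have "1/2 \<le> b" using b by simp
  from that[OF this fb b(2) k] show thesis .
qed

lemma wval_first_leaf: "wval (leaves T ! 0) = 0"
  by (induction T) (auto simp: nth_append leaves_not_Nil)

lemma hd_first_leaf: "T \<noteq> Leaf \<Longrightarrow> \<not> hd (leaves T ! 0)"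
  by (cases T) (auto simp: nth_append leaves_not_Nil)

lemma length_leaves_eq_1_iff: "length (leaves T) = 1 \<longleftrightarrow> T = Leaf"
proof (cases T)
  case (Caret l r)
  have "0 < length (leaves l)" "0 < length (leaves r)" using leaves_not_Nil by auto
  hence "length (leaves T) \<noteq> 1" unfolding Caret leaves.simps length_append length_map by linarith
  thus ?thesis using Caret by simp
qed simp

text \<open>A coloring matches the signs of opposed leaves only up to a global e. Both leftmost
  leaves begin with 0, so an even slope exponent at 0 forces e = 1.\<close>

lemma planar_3_colorable_even_subset: "planar_3_colorable_even \<subseteq> even_F"
proof
  fix f assume "f \<in> planar_3_colorable_even"
  then obtain Tp Tm d k where f: "f \<in> carrier thompson_F"
    and diag: "tree_diagram_of Tp Tm f" and col: "three_colorable Tp Tm"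
    and d: "(f has_real_derivative d) (at 0 within {0..1})" "log 2 d = 2 * of_int (k::int)"
    unfolding planar_3_colorable_even_def planar_3_colorable_subgroup_def thompson_K_def by auto
  have len: "length (leaves Tp) = length (leaves Tm)" using diag by (simp add: tree_diagram_of_iff)
  have "even_at f x" if x: "x \<in> {0..<1}" for x
  \<comment> \<open>The trivial diagram has the empty word as its leaf, to which signs do not apply;
    there f is the identity on [0,1).\<close>
  proof (cases "Tp = Leaf")
    case True
    hence "Tm = Leaf" using len length_leaves_eq_1_iff by metis
    hence s: "has_rslope f x 0" and "f x = x"
      using tree_diagram_even_at_iff(1)[OF diag _ refl refl x, of 0] diag x True
      by (auto simp: tree_diagram_of_iff)
    thus ?thesis using even_at_iff[OF s] by simp
  next
    case False
    hence ne: "Tp \<noteq> Leaf" "Tm \<noteq> Leaf" using len length_leaves_eq_1_iff by metis+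
    have nonnil: "leaves Tp ! k \<noteq> []" "leaves Tm ! k \<noteq> []" if "k < length (leaves Tp)" for k
      using ne that len Nil_notin_leaves_Caret by (metis bintree.exhaust nth_mem)+
    obtain e where e: "\<And>k. k < length (leaves Tp) \<Longrightarrow> word_sign (leaves Tp ! k) = e * word_sign (leaves Tm ! k)"
      and e01: "e \<in> {1, -1}"
      using col unfolding three_colorable_iff[OF ne len] by blast
    have pos: "0 < length (leaves Tp)" using leaves_not_Nil by simp
    have "has_rslope f 0 (int (length (leaves Tp ! 0)) - int (length (leaves Tm ! 0)))"
      using tree_diagram_even_at_iff(1)[OF diag pos refl refl, of 0] by (simp add: wval_first_leaf)
    from rslope_at_0_even[OF this d]
    have "even (length (leaves Tp ! 0)) \<longleftrightarrow> even (length (leaves Tm ! 0))" by auto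
    hence "word_sign (leaves Tp ! 0) = word_sign (leaves Tm ! 0)"
      using hd_first_leaf[OF ne(1)] hd_first_leaf[OF ne(2)] by (simp add: word_sign_def)
    hence "e * word_sign (leaves Tm ! 0) = word_sign (leaves Tm ! 0)" using e[OF pos] by simp
    moreover have "- word_sign w \<noteq> word_sign w" for w by (simp add: word_sign_def)
    ultimately have e1: "e = 1" using e01 by (metis insertE mult_minus1 singletonD)
    obtain v y where v: "v \<in> set (leaves Tp)" "y \<in> {0..<1}" "x = wval v + y / 2 ^ length v"
      using leaves_cover[OF x] by blast
    obtain k where k: "k < length (leaves Tp)" "v = leaves Tp ! k"
      using v(1) by (auto simp: in_set_conv_nth)
    have "word_sign v = word_sign (leaves Tm ! k)" using e[OF k(1)] e1 k(2) by simp
    thus ?thesis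
      using tree_diagram_even_at_iff(2)[OF diag k(1) k(2) refl v(2)] nonnil[OF k(1)]
      unfolding word_sign_eq_iff v(3) k(2) by blast
  qed
  with f show "f \<in> even_F" by (simp add: even_F_def)
qed

text \<open>At the left ends of the leaves the cocycle condition makes opposed signs equal, so every
  diagram of f is colorable. Near each end of the interval x and f x lie on the same side, hence
  both end slopes have even exponents.\<close>

lemma even_F_subset: "even_F \<subseteq> planar_3_colorable_even"
proof
  fix f assume ef: "f \<in> even_F"
  hence f: "f \<in> carrier thompson_F" and ev: "\<And>x. x \<in> {0..<1} \<Longrightarrow> even_at f x"
    by (auto simp: even_F_def)
  obtain Tp Tm where diag: "tree_diagram_of Tp Tm f" using thompson_F_tree_diagram[OF f] by blast
  have len: "length (leaves Tp) = length (leaves Tm)" using diag by (simp add: tree_diagram_of_iff)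
  have "three_colorable Tp Tm"
  proof (cases "Tp = Leaf")
    case True
    hence "Tm = Leaf" using len length_leaves_eq_1_iff by metis
    with True show ?thesis unfolding three_colorable_def edge_separates_def by auto
  next
    case False
    hence ne: "Tp \<noteq> Leaf" "Tm \<noteq> Leaf" using len length_leaves_eq_1_iff by metis+
    have "word_sign (leaves Tp ! k) = 1 * word_sign (leaves Tm ! k)" if k: "k < length (leaves Tp)" for k
    proof -
      have "leaves Tp ! k \<noteq> []" "leaves Tm ! k \<noteq> []"
        using ne k len Nil_notin_leaves_Caret by (metis bintree.exhaust nth_mem)+
      moreover have "even_at f (wval (leaves Tp ! k) + 0 / 2 ^ length (leaves Tp ! k))"
        using ev wval_nonneg wval_lt_1 by simp
      ultimately have "word_sign (leaves Tp ! k) = word_sign (leaves Tm ! k)"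
        using tree_diagram_even_at_iff(2)[OF diag k refl refl, of 0] unfolding word_sign_eq_iff by simp
      thus ?thesis by simp
    qed
    thus ?thesis unfolding three_colorable_iff[OF ne len] by blast
  qed
  hence "f \<in> planar_3_colorable_subgroup"
    using f diag unfolding planar_3_colorable_subgroup_def by blast
  moreover have "f \<in> thompson_K 2 2"
  proof -
    obtain j where j: "has_rslope f 0 j" using has_rslope_ex[OF f, of 0] by auto
    have "even j" using ev[of 0] even_at_iff[OF j] thompson_F_0[OF f] by simp
    then obtain i where "j = 2 * i" by blast
    hence 0: "\<exists>d. (f has_real_derivative d) (at 0 within {0..1}) \<and> (\<exists>k::int. log 2 d = real 2 * of_int k)"
      using has_rslope_derivative[OF j] log2_powi[of j] by (intro exI[of _ "2 powi j"] conjI exI[of _ i]) auto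
    obtain b k where b: "1/2 \<le> b" "1/2 \<le> f b" "b < 1"
      and fb: "\<And>x. b \<le> x \<Longrightarrow> x \<le> 1 \<Longrightarrow> f x = f b + 2 powi k * (x - b)"
      using thompson_F_last_slope[OF f] by metis
    have "has_rslope f b k" by (rule has_rslopeI[OF b(3) order_refl fb])
    from even_at_iff[OF this] ev[of b] b have "even k" by simp
    then obtain i where i: "k = 2 * i" by blast
    have "((\<lambda>y. f b + 2 powi k * (y - b)) has_real_derivative 2 powi k) (at 1 within {0..1})"
      by (auto intro!: derivative_eq_intros)
    hence "(f has_real_derivative 2 powi k) (at 1 within {0..1})"
    proof (rule has_field_derivative_transform_within)
      show "0 < 1 - b" using b by simp
      fix y :: real assume "y \<in> {0..1}" "dist y 1 < 1 - b"
      hence "b \<le> y" "y \<le> 1" by (auto simp: dist_real_def)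
      from fb[OF this] show "f b + 2 powi k * (y - b) = f y" ..
    qed simp
    hence "\<exists>d. (f has_real_derivative d) (at 1 within {0..1}) \<and> (\<exists>k::int. log 2 d = real 2 * of_int k)"
      using log2_powi[of k] i by (intro exI[of _ "2 powi k"] conjI exI[of _ i]) auto
    with 0 f show ?thesis unfolding thompson_K_def by blast
  qed
  ultimately show "f \<in> planar_3_colorable_even" unfolding planar_3_colorable_even_def by blast
qed

lemma planar_3_colorable_even_eq: "planar_3_colorable_even = even_F"
  using planar_3_colorable_even_subset even_F_subset by blast

text \<open>Slopes \<open>1/4, 2, 1, 4\<close> with breaks at \<open>1/2, 11/16, 15/16\<close>. Since \<open>push\<close> maps \<open>11/16\<close> to \<open>1/2\<close>,
  only the slope \<open>2\<close> occurs where \<open>x\<close> and \<open>push x\<close> lie on different sides of \<open>1/2\<close>.\<close>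

definition push :: "real \<Rightarrow> real" where
  "push = (\<lambda>t\<in>{0..1}. t / 4 + max 0 (7/4 * t - 7/8) - max 0 (t - 11/16) + max 0 (3 * t - 45/16))"

text \<open>Slope 1/4 takes 1/2 to 1/8, and slope 2 needs length 3/16 to climb from there to 1/2,
  which gives 11/16. The remaining length 5/16 must cover 1/2 with slopes 1 and 4, so slope 4
  occupies the last 1/16. Each \<open>max\<close> in the definition adds the jump of slope at one
  break and keeps continuity evident.\<close>

lemma push_piecewise:
  "0 \<le> t \<Longrightarrow> t \<le> 1/2 \<Longrightarrow> push t = t / 4"
  "1/2 \<le> t \<Longrightarrow> t \<le> 11/16 \<Longrightarrow> push t = 2 * t - 7/8"
  "11/16 \<le> t \<Longrightarrow> t \<le> 15/16 \<Longrightarrow> push t = t - 3/16"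
  "15/16 \<le> t \<Longrightarrow> t \<le> 1 \<Longrightarrow> push t = 4 * t - 3"
  by (auto simp: push_def max_def)

lemma push_less: "0 < t \<Longrightarrow> t < 1 \<Longrightarrow> push t < t"
  by (auto simp: push_def max_def)

lemma push_affine:
  assumes "0 \<le> a" "a < b" "b \<le> 1" "{a<..<b} \<inter> {1/2, 11/16, 15/16} = {}"
  shows "\<exists>k::int. \<forall>x\<in>{a..b}. push x = push a + 2 powi k * (x - a)"
proof -
  have "b \<le> c \<or> c \<le> a" if "c \<in> {1/2, 11/16, 15/16}" for c
    using that assms(4) by (meson disjoint_iff greaterThanLessThan_iff not_le)
  hence "b \<le> 1/2 \<or> 1/2 \<le> a" "b \<le> 11/16 \<or> 11/16 \<le> a" "b \<le> 15/16 \<or> 15/16 \<le> a"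
    by blast+
  then consider "b \<le> 1/2" | "1/2 \<le> a" "b \<le> 11/16" | "11/16 \<le> a" "b \<le> 15/16" | "15/16 \<le> a" by fastforce
  thus ?thesis
  proof cases
    case 1
    thus ?thesis using assms(1-3) by (intro exI[of _ "-2"]) (auto simp: push_piecewise power_int_minus field_simps)
  next
    case 2
    thus ?thesis using assms(1-3) by (intro exI[of _ 1]) (auto simp: push_piecewise)
  next
    case 3
    thus ?thesis using assms(1-3) by (intro exI[of _ 0]) (auto simp: push_piecewise)
  next
    case 4
    thus ?thesis using assms(1-3) by (intro exI[of _ 2]) (auto simp: push_piecewise)
  qed
qed

lemma push_in_thompson_F: "push \<in> carrier thompson_F"
proof -
  have cont: "continuous_on {0..1} push"
    unfolding push_def by (intro continuous_on_cong[THEN iffD2, OF refl restrict_apply']) (auto intro!: continuous_intros)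
  have mono: "push s < push t" if "0 \<le> s" "s < t" "t \<le> 1" for s t
    using that by (auto simp: push_def max_def)
  have inj: "inj_on push {0..1}"
  proof (rule inj_onI)
    fix s t assume "s \<in> {0..1}" "t \<in> {0..1}" "push s = push t"
    thus "s = t" using mono[of s t] mono[of t s] by (cases s t rule: linorder_cases) auto
  qed
  have ends: "push 0 = 0" "push 1 = 1" by (auto simp: push_piecewise)
  have "push ` {0..1} = {0..1}"
  proof
    show "push ` {0..1} \<subseteq> {0..1}" by (auto simp: push_def max_def)
    show "{0..1} \<subseteq> push ` {0..1}"
    proof
      fix y :: real assume "y \<in> {0..1}"
      hence "push 0 \<le> y" "y \<le> push 1" using ends by auto
      then obtain x where "0 \<le> x" "x \<le> 1" "push x = y" using IVT'[of push 0 y 1] cont by auto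
      thus "y \<in> push ` {0..1}" by auto
    qed
  qed
  from homeomorphism_compact[OF compact_Icc cont this inj]
  obtain g where g: "homeomorphism {0..1} {0..1} push g" by blast
  have ext: "push \<in> extensional {0..1}" by (simp add: push_def)
  have aff: "affine_off {1/2, 11/16, 15/16} push"
    by (rule affine_offI) (rule push_affine)
  have dyadic: "of_int m / 2 ^ n \<in> dyadic_rationals" for m n
    unfolding dyadic_rationals_def by blast
  show ?thesis unfolding thompson_F_iff
  proof (intro conjI exI)
    show "{1/2, 11/16, 15/16} \<subseteq> dyadic_rationals"
      using dyadic[of 1 1] dyadic[of 11 4] dyadic[of 15 4] by simp
    show "finite {1/2, 11/16, 15/16 :: real}" by simp
  qed (rule ext g aff)+
qed

lemma push_in_even_F: "push \<in> even_F"
proof -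
  have "even_at push x" if x: "x \<in> {0..<1}" for x
  proof -
    consider "x < 1/2" | "1/2 \<le> x" "x < 11/16" | "11/16 \<le> x" "x < 15/16" | "15/16 \<le> x" by linarith
    thus ?thesis
    proof cases
      case 1
      hence "has_rslope push x (- 2)" using x
        by (intro has_rslopeI[of _ "1/2"]) (auto simp: push_piecewise power_int_minus field_simps)
      from even_at_iff[OF this] show ?thesis using 1 x by (simp add: push_piecewise)
    next
      case 2
      hence "has_rslope push x 1"
        by (intro has_rslopeI[of _ "11/16"]) (auto simp: push_piecewise)
      from even_at_iff[OF this] show ?thesis using 2 by (simp add: push_piecewise)
    next
      case 3
      hence "has_rslope push x 0"
        by (intro has_rslopeI[of _ "15/16"]) (auto simp: push_piecewise)
      from even_at_iff[OF this] show ?thesis using 3 by (simp add: push_piecewise)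
    next
      case 4
      hence "has_rslope push x 2" using x
        by (intro has_rslopeI[of _ 1]) (auto simp: push_piecewise)
      from even_at_iff[OF this] show ?thesis using 4 x by (simp add: push_piecewise)
    qed
  qed
  with push_in_thompson_F show ?thesis by (simp add: even_F_def)
qed

section \<open>Dynamics towards 0\<close>

text \<open>Orbits approach 0 without having to reach it, so the value at 0 must be spread to a
  neighbourhood. There the exponent is constant and both x and f x stay below 1/2.\<close>

lemma even_at_near_0:
  assumes f: "f \<in> carrier thompson_F" and ev: "even_at f 0"
  obtains e where "0 < e" "e \<le> 1" "\<And>x. 0 \<le> x \<Longrightarrow> x < e \<Longrightarrow> even_at f x"
proof -
  obtain k where s: "has_rslope f 0 k" using has_rslope_ex[OF f, of 0] by auto
  have k: "even k" using ev even_at_iff[OF s] thompson_F_0[OF f] by simp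
  obtain d where d: "0 < d" "d \<le> 1" and fd: "\<And>y. 0 \<le> y \<Longrightarrow> y \<le> d \<Longrightarrow> f y = 2 powi k * y"
    using s thompson_F_0[OF f] unfolding has_rslope_def by auto
  \<comment> \<open>The last bound keeps the image 2 powi k * x below 1/2.\<close>
  define e where "e = min d (min (1/2) (1 / (2 * 2 powi k)))"
  have e: "0 < e" "e \<le> 1" using d by (auto simp: e_def)
  have "even_at f x" if x: "0 \<le> x" "x < e" for x
  proof -
    have "x < d" "x < 1/2" "x < 1 / (2 * 2 powi k)" using x by (auto simp: e_def)
    moreover have "f y = f x + 2 powi k * (y - x)" if "x \<le> y" "y \<le> d" for y
      using fd[of x] fd[of y] x that \<open>x < d\<close> by (simp add: algebra_simps)
    hence "has_rslope f x k" by (rule has_rslopeI[OF \<open>x < d\<close> d(2)])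
    moreover have "f x < 1/2" using fd[of x] x(1) \<open>x < d\<close> \<open>x < 1 / (2 * 2 powi k)\<close>
      by (simp add: field_simps)
    ultimately show ?thesis using k even_at_iff by blast
  qed
  with e that show thesis by blast
qed

text \<open>The iterates decrease and are bounded below. By continuity their limit is a fixed point
  below 1, and only 0 is one.\<close>

lemma thompson_F_iterates_tendsto_0:
  assumes f: "f \<in> carrier thompson_F" and less: "\<And>x. 0 < x \<Longrightarrow> x < 1 \<Longrightarrow> f x < x" and x: "x \<in> {0..<1}"
  shows "(\<lambda>n. (f ^^ n) x) \<longlonglongrightarrow> 0"
proof -
  let ?s = "\<lambda>n. (f ^^ n) x"
  have range: "?s n \<in> {0..<1}" for n
    by (induction n) (use x thompson_F_range_less[OF f] in auto)
  have le: "f y \<le> y" if "y \<in> {0..<1}" for y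
    using less[of y] thompson_F_0[OF f] that by (cases "y = 0") auto
  have dec: "decseq ?s" unfolding decseq_Suc_iff using le[OF range] by simp
  obtain L where L: "?s \<longlonglongrightarrow> L" using decseq_convergent[OF dec, of 0] range by fastforce
  have "0 \<le> L" using range by (intro LIMSEQ_le_const[OF L]) auto
  moreover have "L \<le> x" using decseq_ge[OF dec L, of 0] by simp
  ultimately have L01: "L \<in> {0..<1}" using x by auto
  have "(\<lambda>n. f (?s n)) \<longlonglongrightarrow> f L"
    by (rule continuous_on_tendsto_compose[OF thompson_F_continuous[OF f] L])
      (use L01 range in \<open>auto intro!: always_eventually less_imp_le\<close>)
  moreover have "(\<lambda>n. f (?s n)) \<longlonglongrightarrow> L" using LIMSEQ_Suc[OF L] by simp
  ultimately have "f L = L" by (rule LIMSEQ_unique)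
  hence "L = 0" using less[of L] L01 by force
  with L show ?thesis by simp
qed

text \<open>The truth value of \<open>even_at g\<close> is constant along the orbits of \<open>f\<close>, and these accumulate at \<open>0\<close>.\<close>

lemma even_F_conjugate_cancel:
  assumes f: "f \<in> even_F" and less: "\<And>x. 0 < x \<Longrightarrow> x < 1 \<Longrightarrow> f x < x"
    and g: "g \<in> carrier thompson_F" "even_at g 0" and k: "k \<in> even_F"
    and eq: "f \<otimes>\<^bsub>thompson_F\<^esub> g = g \<otimes>\<^bsub>thompson_F\<^esub> k"
  shows "g \<in> even_F"
proof -
  have fc: "f \<in> carrier thompson_F" and kc: "k \<in> carrier thompson_F" using f k by (auto simp: even_F_def)
  \<comment> \<open>Evaluate the cocycle on both sides of \<open>eq\<close>: the contributions of f
    and k are trivial, leaving g at f x and g at x.\<close>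
  have inv: "even_at g (f x) \<longleftrightarrow> even_at g x" if x: "x \<in> {0..<1}" for x
  proof -
    have "even_at (f \<otimes>\<^bsub>thompson_F\<^esub> g) x \<longleftrightarrow> even_at g (f x)"
      using even_at_mult[OF fc g(1) x] f x by (simp add: even_F_def)
    moreover have "even_at (g \<otimes>\<^bsub>thompson_F\<^esub> k) x \<longleftrightarrow> even_at g x"
      using even_at_mult[OF g(1) kc x] k thompson_F_range_less[OF g(1) x] by (simp add: even_F_def)
    ultimately show ?thesis unfolding eq by simp
  qed
  obtain e where e: "0 < e" "\<And>x. 0 \<le> x \<Longrightarrow> x < e \<Longrightarrow> even_at g x"
    using even_at_near_0[OF g] by metis
  have "even_at g x" if x: "x \<in> {0..<1}" for x
  proof -
    have range: "(f ^^ n) x \<in> {0..<1}" for n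
      by (induction n) (use x thompson_F_range_less[OF fc] in auto)
    have iter: "even_at g ((f ^^ n) x) \<longleftrightarrow> even_at g x" for n
      by (induction n) (use inv[OF range] in auto)
    obtain n where "(f ^^ n) x < e"
      using order_tendstoD(2)[OF thompson_F_iterates_tendsto_0[OF fc less x] e(1)]
      by (auto simp: eventually_sequentially)
    hence "even_at g ((f ^^ n) x)" using e(2) range[of n] by auto
    thus ?thesis using iter by simp
  qed
  with g(1) show ?thesis by (simp add: even_F_def)
qed

lemma thompson_K_even_at_0: "g \<in> thompson_K 2 b \<Longrightarrow> even_at g 0"
proof -
  assume "g \<in> thompson_K 2 b"
  then obtain d k where g: "g \<in> carrier thompson_F"
    and d: "(g has_real_derivative d) (at 0 within {0..1})" "log 2 d = 2 * of_int (k::int)"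
    unfolding thompson_K_def by auto
  obtain j where j: "has_rslope g 0 j" using has_rslope_ex[OF g, of 0] by auto
  show ?thesis using even_at_iff[OF j] rslope_at_0_even[OF j d] thompson_F_0[OF g] by simp
qed

text \<open>Freeness is verified after applying \<alpha>, where h becomes \<open>push\<close>. The
  image of g lies in \<open>thompson_K 2 b\<close>, and this provides the trivial cocycle value at 0
  that \<open>even_F_conjugate_cancel\<close> requires.\<close>

lemma quasi_regular_irreducible_vimage:
  assumes \<alpha>: "\<alpha> \<in> iso thompson_F (thompson_F\<lparr>carrier := thompson_K 2 b\<rparr>)"
    and sub: "even_F \<subseteq> thompson_K 2 b"
  shows "quasi_regular_irreducible thompson_F {f \<in> carrier thompson_F. \<alpha> f \<in> even_F}"
    (is "quasi_regular_irreducible _ ?H")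
proof -
  interpret F: group thompson_F by (rule group_thompson_F)
  have K: "thompson_K 2 b \<subseteq> carrier thompson_F" by (auto simp: thompson_K_def)
  have bij: "\<alpha> ` carrier thompson_F = thompson_K 2 b"
    using \<alpha> by (auto simp: iso_def bij_betw_def)
  have "\<alpha> \<in> hom thompson_F thompson_F"
    using \<alpha> K by (auto simp: iso_def hom_def)
  then interpret \<alpha>: group_hom thompson_F thompson_F \<alpha>
    by (simp add: group_hom_def group_hom_axioms_def group_thompson_F)
  have H: "subgroup ?H thompson_F"
  proof (rule F.subgroupI)
    show "?H \<noteq> {}" using subgroup.one_closed[OF subgroup_even_F] \<alpha>.hom_one by force
  qed (auto simp: subgroup.m_inv_closed[OF subgroup_even_F] subgroup.m_closed[OF subgroup_even_F])
  obtain h where h: "h \<in> carrier thompson_F" "\<alpha> h = push"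
    using push_in_even_F sub bij by (metis imageE subsetD)
  show ?thesis
  proof (rule F.quasi_regular_irreducibleI[OF H])
    show "h \<in> ?H" using h push_in_even_F by simp
    fix g n assume g: "g \<in> carrier thompson_F" "g \<notin> ?H" and n: "0 < (n::nat)"
    show "inv\<^bsub>thompson_F\<^esub> g \<otimes>\<^bsub>thompson_F\<^esub> h [^]\<^bsub>thompson_F\<^esub> n \<otimes>\<^bsub>thompson_F\<^esub> g \<notin> ?H"
    proof
      assume *: "inv\<^bsub>thompson_F\<^esub> g \<otimes>\<^bsub>thompson_F\<^esub> h [^]\<^bsub>thompson_F\<^esub> n \<otimes>\<^bsub>thompson_F\<^esub> g \<in> ?H"
      let ?p = "push [^]\<^bsub>thompson_F\<^esub> n" and ?g = "\<alpha> g"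
      let ?k = "inv\<^bsub>thompson_F\<^esub> ?g \<otimes>\<^bsub>thompson_F\<^esub> ?p \<otimes>\<^bsub>thompson_F\<^esub> ?g"
      have gc: "?g \<in> carrier thompson_F" using g by simp
      have "push [^]\<^bsub>thompson_F\<^esub> m \<in> even_F" for m :: nat
        by (induction m) (auto simp: subgroup.one_closed[OF subgroup_even_F]
          subgroup.m_closed[OF subgroup_even_F] push_in_even_F)
      hence p: "?p \<in> even_F" .
      have pc: "?p \<in> carrier thompson_F" using push_in_thompson_F by simp
      have k: "?k \<in> even_F" using * g h by (simp add: \<alpha>.hom_nat_pow)
      \<comment> \<open>Powers start at exponent 1, since the zeroth power fixes every point. The
        product is in order of application, so the added factor acts last, on the image under the
        smaller power.\<close>
      have less: "(push [^]\<^bsub>thompson_F\<^esub> Suc m) x < x" if "0 < x" "x < 1" for m x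
        using that
      proof (induction m arbitrary: x)
        case 0
        then show ?case using push_less push_in_thompson_F by simp
      next
        case (Suc m)
        let ?q = "push [^]\<^bsub>thompson_F\<^esub> Suc m"
        have q: "?q \<in> carrier thompson_F" using push_in_thompson_F by (rule F.nat_pow_closed)
        have "0 < ?q x" using thompson_F_strict_mono[OF q, of 0 x] thompson_F_0[OF q] Suc.prems by simp
        moreover have "?q x < x" by (rule Suc.IH[OF Suc.prems])
        ultimately have "push (?q x) < ?q x" using push_less Suc.prems by simp
        with \<open>?q x < x\<close> show ?case
          unfolding F.nat_pow_Suc[of _ "Suc m"] using Suc.prems by (simp add: thompson_F_mult_apply)
      qed
      have "?p \<otimes>\<^bsub>thompson_F\<^esub> ?g = ?g \<otimes>\<^bsub>thompson_F\<^esub> ?k"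
        using gc pc by (simp add: F.m_assoc[symmetric])
      moreover have "even_at ?g 0" using bij g(1) thompson_K_even_at_0 by blast
      moreover have "\<And>x. 0 < x \<Longrightarrow> x < 1 \<Longrightarrow> ?p x < x" using less[of _ "n - 1"] n by simp
      ultimately have "?g \<in> even_F" using even_F_conjugate_cancel[OF p _ gc _ k] by blast
      with g show False by simp
    qed
  qed
qed

theorem corollary3p10:
  fixes \<alpha> \<theta> :: "(real \<Rightarrow> real) \<Rightarrow> (real \<Rightarrow> real)"
  assumes "\<alpha> \<in> iso thompson_F (thompson_F\<lparr>carrier := thompson_K 2 1\<rparr>)"
    and "\<alpha> thompson_x0 =
      thompson_x0 \<otimes>\<^bsub>thompson_F\<^esub> thompson_x1
        \<otimes>\<^bsub>thompson_F\<^esub> thompson_x0 [^]\<^bsub>thompson_F\<^esub> (- 3 :: int)"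
    and "\<alpha> thompson_x1 =
      thompson_x0 \<otimes>\<^bsub>thompson_F\<^esub> thompson_x1 [^]\<^bsub>thompson_F\<^esub> (2 :: int)
        \<otimes>\<^bsub>thompson_F\<^esub> thompson_x0 [^]\<^bsub>thompson_F\<^esub> (- 3 :: int)"
    and "\<theta> \<in> iso thompson_F (thompson_F\<lparr>carrier := thompson_K 2 2\<rparr>)"
    and "\<theta> thompson_x0 =
      thompson_x0 \<otimes>\<^bsub>thompson_F\<^esub> thompson_x1
        \<otimes>\<^bsub>thompson_F\<^esub> thompson_x0 [^]\<^bsub>thompson_F\<^esub> (- 3 :: int)
        \<otimes>\<^bsub>thompson_F\<^esub> thompson_x1 [^]\<^bsub>thompson_F\<^esub> (- 1 :: int)"
    and "\<theta> thompson_x1 =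
      thompson_x0 \<otimes>\<^bsub>thompson_F\<^esub> thompson_x1 [^]\<^bsub>thompson_F\<^esub> (2 :: int)
        \<otimes>\<^bsub>thompson_F\<^esub> thompson_x0 [^]\<^bsub>thompson_F\<^esub> (- 3 :: int)"
  shows "quasi_regular_irreducible thompson_F
           {f \<in> carrier thompson_F. \<alpha> f \<in> planar_3_colorable_even} \<and>
         quasi_regular_irreducible thompson_F
           {f \<in> carrier thompson_F. \<theta> f \<in> planar_3_colorable_even}"
proof -
  have K22: "even_F \<subseteq> thompson_K 2 2"
    using planar_3_colorable_even_eq unfolding planar_3_colorable_even_def by blast
  \<comment> \<open>An even exponent at 1 is in particular an integer, so the ranges of both
    isomorphisms contain \<open>even_F\<close>.\<close>
  have "thompson_K 2 2 \<subseteq> thompson_K 2 1"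
  proof
    fix f assume f: "f \<in> thompson_K 2 2"
    then obtain d k where "(f has_real_derivative d) (at 1 within {0..1})" "log 2 d = real 2 * of_int (k::int)"
      unfolding thompson_K_def by blast
    hence "(f has_real_derivative d) (at 1 within {0..1}) \<and> (\<exists>k::int. log 2 d = real 1 * of_int k)"
      by (auto intro!: exI[of _ "2 * k"])
    with f show "f \<in> thompson_K 2 1" unfolding thompson_K_def by blast
  qed
  with K22 have K21: "even_F \<subseteq> thompson_K 2 1" by blast
  show ?thesis
    unfolding planar_3_colorable_even_eq
    using quasi_regular_irreducible_vimage[OF assms(1) K21] quasi_regular_irreducible_vimage[OF assms(4) K22]
    by blast
qed

end
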